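(* Let $1<p<\infty$, $-1<\alpha<\infty$, let $K\ge0$ be an integer, and let $f\in A^p_\alpha$. Suppose that $D_\theta^K f\in\Lambda^*_{1,A^p_\alpha}$ and $\|D_\theta^K f\|_{\Lambda^*,1,A^p_\alpha}=M$. Then for every integer $n\ge1$, $$E_n^{p,\alpha}(f)\le\widetilde{B}_K\,M\,n^{-K-1},\qquad \widetilde{B}_K=2^K\left(\frac{C_{K+2}}{\pi}+\pi C_K\right).$$
   Context: $\mathbb{D}$ is the open unit disc. For $1<p<\infty$, $\alpha>-1$, the weighted Bergman space $A^p_\alpha$ is the space of analytic functions $f$ in $\mathbb{D}$ with $\|f\|_{p,\alpha}=\left(\int_{\mathbb{D}}|f|^p\,dA_\alpha\right)^{1/p}<\infty$, where $dA_\alpha=(\alpha+1)\pi^{-1}(1-|z|^2)^\alpha\,dA(z)$ and $dA$ is Lebesgue area measure. $D_\theta^K f(re^{i\theta})=\frac{\partial^K}{\partial\theta^K}f(re^{i\theta})$. For $g\in A^p_\alpha$ we say $g\in\Lambda^*_{\beta,A^p_\alpha}$ if there is a constant $C$ with $\|g(e^{it}\cdot)+g(e^{-it}\cdot)-2g(\cdot)\|_{p,\alpha}\le C|t|^\beta$ for all real $t$; $\|g\|_{\Lambda^*,\beta,A^p_\alpha}$ denotes the infimum of such constants $C$. $E_n^{p,\alpha}(f)=\min\{\|f-P\|_{p,\alpha}: P \text{ a polynomial of degree at most } n\}$. The constants are $C_k=\frac4\pi\int_0^\infty|H_k(t)|\,dt$, where $H_0(t)=h(t)/t^2$, $H_k(t)=\int_t^\infty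 H_{k-1}(x)\,dx$ for $k\ge1$, and $h(t)=(\cos(t)-\cos(2t))/2$. *)

theory Defs
  imports "HOL-Analysis.Analysis"
begin

text \<open>Functions on the unit disc are total functions \<^typ>\<open>complex \<Rightarrow> complex\<close>; their values
  outside the disc are irrelevant, because the measure \<open>dA\<^sub>\<alpha>\<close> lives on the disc.\<close>

definition area_measure :: "real \<Rightarrow> complex measure" where
  "area_measure \<alpha> =
     density (restrict_space lborel (ball 0 1))
       (\<lambda>z. ennreal ((\<alpha> + 1) / pi * (1 - (cmod z)\<^sup>2) powr \<alpha>))"

definition bergman_space :: "real \<Rightarrow> real \<Rightarrow> (complex \<Rightarrow> complex) set" where
  "bergman_space p \<alpha> =
     {f. f holomorphic_on ball 0 1 \<and>
         integrable (area_measure \<alpha>) (\<lambda>z. cmod (f z) powr p)}"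

definition bergman_norm :: "real \<Rightarrow> real \<Rightarrow> (complex \<Rightarrow> complex) \<Rightarrow> real" where
  "bergman_norm p \<alpha> f =
     (LINT z|area_measure \<alpha>. cmod (f z) powr p) powr (1 / p)"

text \<open>The \<open>K\<close>-th derivative of \<open>\<theta> \<mapsto> f (r e\<^sup>i\<^sup>\<theta>)\<close>, evaluated at the polar coordinates
  \<open>r = cmod z\<close>, \<open>\<theta> = Arg z\<close>. Since \<open>\<theta> \<mapsto> f (r e\<^sup>i\<^sup>\<theta>)\<close> is \<open>2\<pi>\<close>-periodic, the choice of the
  branch of the argument is immaterial.\<close>

definition D_theta :: "nat \<Rightarrow> (complex \<Rightarrow> complex) \<Rightarrow> complex \<Rightarrow> complex" where
  "D_theta K f z =
     ((\<lambda>u \<theta>. vector_derivative u (at \<theta>)) ^^ K) (\<lambda>\<theta>. f (rcis (cmod z) \<theta>)) (Arg z)"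

definition zygmund_bound ::
    "real \<Rightarrow> real \<Rightarrow> real \<Rightarrow> (complex \<Rightarrow> complex) \<Rightarrow> real \<Rightarrow> bool" where
  "zygmund_bound \<beta> p \<alpha> g C \<longleftrightarrow>
     (\<forall>t::real. bergman_norm p \<alpha> (\<lambda>z. g (cis t * z) + g (cis (- t) * z) - 2 * g z)
                  \<le> C * \<bar>t\<bar> powr \<beta>)"

definition zygmund_space :: "real \<Rightarrow> real \<Rightarrow> real \<Rightarrow> (complex \<Rightarrow> complex) set" where
  "zygmund_space \<beta> p \<alpha> = {g \<in> bergman_space p \<alpha>. \<exists>C. zygmund_bound \<beta> p \<alpha> g C}"

definition zygmund_seminorm :: "real \<Rightarrow> real \<Rightarrow> real \<Rightarrow> (complex \<Rightarrow> complex) \<Rightarrow> real" where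
  "zygmund_seminorm \<beta> p \<alpha> g = Inf {C. zygmund_bound \<beta> p \<alpha> g C}"

text \<open>The infimum is a minimum, since the polynomials of degree at most \<open>n\<close> form a
  finite-dimensional space.\<close>

definition best_approx :: "nat \<Rightarrow> real \<Rightarrow> real \<Rightarrow> (complex \<Rightarrow> complex) \<Rightarrow> real" where
  "best_approx n p \<alpha> f =
     Inf {bergman_norm p \<alpha> (\<lambda>z. f z - poly P z) | P :: complex poly. degree P \<le> n}"

definition h_fun :: "real \<Rightarrow> real" where
  "h_fun t = (cos t - cos (2 * t)) / 2"

text \<open>Only values at \<open>t > 0\<close> matter. Each \<open>H_fun k t\<close> is \<open>O(1/t\<^sup>2)\<close> as \<open>t \<rightarrow> \<infinity>\<close> and bounded
  near \<open>0\<close>, so all integrals below converge absolutely.\<close>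

primrec H_fun :: "nat \<Rightarrow> real \<Rightarrow> real" where
  "H_fun 0 = (\<lambda>t. h_fun t / t\<^sup>2)"
| "H_fun (Suc k) = (\<lambda>t. LBINT x:{t..}. H_fun k x)"

definition C_const :: "nat \<Rightarrow> real" where
  "C_const k = 4 / pi * (LBINT t:{0..}. \<bar>H_fun k t\<bar>)"

definition B_const :: "nat \<Rightarrow> real" where
  "B_const K = 2 ^ K * (C_const (K + 2) / pi + pi * C_const K)"

end

theory Submission
  imports Defs "HOL-Probability.Sinc_Integral" "HOL-Complex_Analysis.Complex_Analysis"
begin

text \<open>
  On Taylor coefficients, convolution in \<open>\<theta>\<close> with the kernel \<open>H\<^sub>0\<close> is the multiplier
  \<open>\<phi>(m/\<sigma>)\<close>, where the trapezoid \<open>\<phi>\<close> equals 1 on \<open>[0,1]\<close> and 0 beyond 2; with \<open>\<sigma> = n/2\<close> it yields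
  a polynomial. Integrating by parts, \<open>(1 - \<phi>(x))/x\<^sup>k\<close> is up to sign the cosine or sine transform of
  \<open>H\<^sub>k\<close>, so removing \<open>\<phi>\<close> costs \<open>C\<^sub>k \<sigma>\<^sup>-\<^sup>k\<close> times the norm of the \<open>k\<close>-th angular derivative.
  Split \<open>g = D\<^sub>\<theta>\<^sup>K f\<close> as \<open>(g - g\<^sub>\<delta>) + g\<^sub>\<delta>\<close> with the second-order Steklov mean \<open>g\<^sub>\<delta>\<close>. Then \<open>g - g\<^sub>\<delta>\<close> has norm at
  most \<open>M\<delta>/6\<close>, while \<open>D\<^sub>\<theta>\<^sup>2 g\<^sub>\<delta>\<close> is a second difference of \<open>g\<close> divided by \<open>\<delta>\<^sup>2\<close>, of norm at most
  \<open>M/\<delta>\<close>. Estimating the two parts with \<open>k = K\<close> and \<open>k = K + 2\<close> and taking \<open>\<delta> = 4\<pi>/n\<close>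
  gives the constant, with \<open>2\<pi>/3\<close> in place of \<open>\<pi>\<close>.
\<close>

section \<open>The kernels \<open>H\<^sub>k\<close> and their transforms\<close>

text \<open>An analytic function has only frequencies \<open>m\<close> \<ge> 0, so a multiplier may
  be continued to negative frequencies with either parity. Hence cosines can serve the even orders
  and sines the odd ones, and no conjugate function has to be estimated. The factors cos(m\<theta>)
  and sin(m\<theta>) are combinations of two rotations, which preserve the norm because the weight
  is radial. The factor 4/pi in \<open>C_const\<close> is the reciprocal of the integral of
  \<open>H_fun 0\<close> over the positive axis; it gives the trapezoid height 1. Order 0 is
  exceptional: its transform is \<phi> itself, while every higher order produces 1 - \<phi>. With
  \<open>s\<close> the multiplier of the Steklov mean, the error is therefore split as 1 - \<phi> s
  = (1 - s) + s (1 - \<phi>) when K = 0, so that the polynomial is built from the Steklov mean; for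
  K \<ge> 1 it is 1 - \<phi> = (1 - s)(1 - \<phi>) + s (1 - \<phi>).\<close>

lemma FTC_Ioi_nonneg:
  fixes f F :: "real \<Rightarrow> real"
  assumes "\<And>x. x > c \<Longrightarrow> DERIV F x :> f x" "\<And>x. x > c \<Longrightarrow> isCont f x"
    and "\<And>x. x > c \<Longrightarrow> f x \<ge> 0" "(F \<longlongrightarrow> A) (at_right c)" "(F \<longlongrightarrow> B) at_top"
  shows "set_integrable lborel {c<..} f" "(LBINT x:{c<..}. f x) = B - A"
proof -
  have A: "((F \<circ> real_of_ereal) \<longlongrightarrow> A) (at_right (ereal c))"
    and B: "((F \<circ> real_of_ereal) \<longlongrightarrow> B) (at_left \<infinity>)"
    using assms by (simp_all add: ereal_tendsto_simps)
  have "set_integrable lborel (einterval (ereal c) \<infinity>) f" "(LBINT x=ereal c..\<infinity>. f x) = B - A"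
    by (rule interval_integral_FTC_nonneg[OF _ _ _ _ A B]; use assms in \<open>auto intro!: AE_I2\<close>)+
  then show "set_integrable lborel {c<..} f" "(LBINT x:{c<..}. f x) = B - A"
    by (simp_all add: interval_lebesgue_integral_def)
qed

lemma FTC_Ioi:
  fixes f F :: "real \<Rightarrow> 'a::euclidean_space"
  assumes "\<And>x. x > c \<Longrightarrow> (F has_vector_derivative f x) (at x)" "\<And>x. x > c \<Longrightarrow> isCont f x"
    and "set_integrable lborel {c<..} f" "(F \<longlongrightarrow> A) (at_right c)" "(F \<longlongrightarrow> B) at_top"
  shows "(LBINT x:{c<..}. f x) = B - A"
proof -
  have "((F \<circ> real_of_ereal) \<longlongrightarrow> A) (at_right (ereal c))" "((F \<circ> real_of_ereal) \<longlongrightarrow> B) (at_left \<infinity>)"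
    using assms by (simp_all add: ereal_tendsto_simps)
  then have "(LBINT x=ereal c..\<infinity>. f x) = B - A"
    by (intro interval_integral_FTC_integrable) (use assms in auto)
  then show ?thesis
    by (simp add: interval_lebesgue_integral_def)
qed

section \<open>Cosine transform of the first kernel\<close>

lemma dirichlet_type_integral:
  fixes a :: real
  shows "set_integrable lborel {0<..} (\<lambda>t. (1 - cos (a * t)) / t\<^sup>2)"
    and "(LBINT t:{0<..}. (1 - cos (a * t)) / t\<^sup>2) = pi * \<bar>a\<bar> / 2"
proof -
  have main: "set_integrable lborel {0<..} (\<lambda>t. (1 - cos (a * t)) / t\<^sup>2) \<and>
      (LBINT t:{0<..}. (1 - cos (a * t)) / t\<^sup>2) = pi * a / 2" if a: "a > 0" for a :: real
  proof -
    \<comment> \<open>Integrating by parts once leaves a sin(at)/t, whose primitive is a Si(at); the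
      limit pi/2 of \<open>Si\<close> at infinity then gives the value.\<close>
    define F where "F = (\<lambda>t. a * Si (a * t) - (1 - cos (a * t)) / t)"
    have D: "DERIV F t :> (1 - cos (a * t)) / t\<^sup>2" if "t > 0" for t
    proof -
      have "DERIV F t :> a * (sinc (a * t) * a) - (a * sin (a * t) * t - (1 - cos (a * t))) / (t * t)"
        unfolding F_def using that a
        by (auto intro!: derivative_eq_intros DERIV_chain'[OF _ DERIV_Si] simp: mult_ac)
      also have "a * (sinc (a * t) * a) - (a * sin (a * t) * t - (1 - cos (a * t))) / (t * t)
          = (1 - cos (a * t)) / t\<^sup>2"
        using that a by (auto simp: field_simps power2_eq_square)
      finally show ?thesis .
    qed
    have "((\<lambda>t. a * Si (a * t)) \<longlongrightarrow> a * Si (a * 0)) (at_right 0)"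
      by (intro tendsto_intros isCont_tendsto_compose[OF isCont_Si])
    moreover have "((\<lambda>t. (1 - cos (a * t)) / t) \<longlongrightarrow> 0) (at_right 0)"
      using a by real_asymp
    ultimately have "(F \<longlongrightarrow> a * Si (a * 0) - 0) (at_right 0)"
      unfolding F_def by (rule tendsto_diff)
    moreover have "Si 0 = 0" by (simp add: Si_def zero_ereal_def)
    ultimately have lim0: "(F \<longlongrightarrow> 0) (at_right 0)" by simp
    have "filterlim (\<lambda>t. a * t) at_top at_top" using a by real_asymp
    then have "((\<lambda>t. Si (a * t)) \<longlongrightarrow> pi / 2) at_top"
      by (rule filterlim_compose[OF Si_at_top])
    then have "((\<lambda>t. a * Si (a * t)) \<longlongrightarrow> a * (pi / 2)) at_top"
      by (rule tendsto_mult_left)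
    moreover have "((\<lambda>t. (1 - cos (a * t)) / t) \<longlongrightarrow> 0) at_top"
      using a by real_asymp
    ultimately have "(F \<longlongrightarrow> a * (pi / 2) - 0) at_top"
      unfolding F_def by (rule tendsto_diff)
    then have lim1: "(F \<longlongrightarrow> pi * a / 2) at_top" by (simp add: mult.commute)
    from FTC_Ioi_nonneg[OF D _ _ lim0 lim1] show ?thesis
      by (auto intro!: continuous_intros)
  qed
  have abs: "cos (a * t) = cos (\<bar>a\<bar> * t)" for t
    by (cases "a \<ge> 0") auto
  show "set_integrable lborel {0<..} (\<lambda>t. (1 - cos (a * t)) / t\<^sup>2)"
    using main[of "\<bar>a\<bar>"] by (cases "a = 0") (auto simp: abs set_integrable_def)
  show "(LBINT t:{0<..}. (1 - cos (a * t)) / t\<^sup>2) = pi * \<bar>a\<bar> / 2"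
    using main[of "\<bar>a\<bar>"] by (cases "a = 0") (auto simp: abs set_lebesgue_integral_def)
qed

text \<open>The product-to-sum formula yields four cosines over \<open>t^2\<close> whose signs add
  up to zero. So 1 may be subtracted from each of them, which makes the four pieces separately
  integrable at 0.\<close>

lemma H_fun_0_cos_transform:
  "(LBINT t:{0<..}. cos (x * t) * H_fun 0 t)
    = pi / 8 * (\<bar>x + 2\<bar> + \<bar>x - 2\<bar> - \<bar>x + 1\<bar> - \<bar>x - 1\<bar>)"
proof -
  have eq: "cos (x * t) * H_fun 0 t = ((1 - cos ((x + 2) * t)) / t\<^sup>2 + (1 - cos ((x - 2) * t)) / t\<^sup>2
      - (1 - cos ((x + 1) * t)) / t\<^sup>2 - (1 - cos ((x - 1) * t)) / t\<^sup>2) / 4" for t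
  proof -
    have "cos (x * t) * cos (c * t) = (cos ((x + c) * t) + cos ((x - c) * t)) / 2" for c
      unfolding cos_times_cos by (simp add: ring_distribs)
    from this[of 1] this[of 2] have "cos (x * t) * cos t = (cos ((x + 1) * t) + cos ((x - 1) * t)) / 2"
      "cos (x * t) * cos (2 * t) = (cos ((x + 2) * t) + cos ((x - 2) * t)) / 2" by simp_all
    then show ?thesis
      by (cases "t = 0") (simp_all add: h_fun_def divide_simps, simp add: algebra_simps)
  qed
  note [simp] = dirichlet_type_integral
  define g :: "real \<Rightarrow> real \<Rightarrow> real" where "g = (\<lambda>a t. (1 - cos (a * t)) / t\<^sup>2)"
  have g: "set_integrable lborel {0<..} (g a)" "(LBINT t:{0<..}. g a t) = pi * \<bar>a\<bar> / 2" for a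
    using dirichlet_type_integral[of a] unfolding g_def by simp_all
  have "(LBINT t:{0<..}. cos (x * t) * H_fun 0 t) =
    (LBINT t:{0<..}. g (x + 2) t + g (x - 2) t - g (x + 1) t - g (x - 1) t) / 4"
    unfolding eq g_def by (rule set_integral_divide_zero)
  also have "\<dots> = (pi * \<bar>x + 2\<bar> / 2 + pi * \<bar>x - 2\<bar> / 2 - pi * \<bar>x + 1\<bar> / 2 - pi * \<bar>x - 1\<bar> / 2) / 4"
    by (simp add: g set_integral_add set_integral_diff)
  finally show ?thesis by (simp add: algebra_simps)
qed

section \<open>Size, decay and integrability of the kernels\<close>

text \<open>From 1 - cos s \<le> s^2/2 at s = t and s = 2t: half of 1/2 + 2 is 5/4. This keeps
  \<open>H_fun 0\<close> bounded near 0.\<close>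

lemma h_fun_bound: "\<bar>h_fun t\<bar> \<le> 5 / 4 * t\<^sup>2"
proof -
  have c: "1 - cos (s::real) \<le> s\<^sup>2 / 2" for s
    using cos_double_sin[of "s / 2"] abs_le_square_iff[THEN iffD1, OF abs_sin_x_le_abs_x[of "s / 2"]]
    by (simp add: power_divide)
  show "\<bar>h_fun t\<bar> \<le> 5 / 4 * t\<^sup>2"
  proof -
    have "1 - cos (2 * t) \<le> 2 * t\<^sup>2" using c[of "2 * t"] by (simp add: power_mult_distrib)
    then have "cos t - cos (2 * t) \<le> 5 / 2 * t\<^sup>2" "- (5 / 2 * t\<^sup>2) \<le> cos t - cos (2 * t)"
      using c[of t] cos_le_one[of t] cos_le_one[of "2*t"] zero_le_power2[of t] by linarith+
    then have "\<bar>cos t - cos (2 * t)\<bar> \<le> 5 / 2 * t\<^sup>2" by linarith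
    then show ?thesis by (simp add: h_fun_def)
  qed
qed

lemma borel_measurable_H_fun [measurable]: "H_fun k \<in> borel_measurable borel"
proof (induction k)
  case 0
  then show ?case unfolding H_fun.simps h_fun_def by measurable
next
  case (Suc k)
  note [measurable] = Suc
  have "(\<lambda>t. LINT x|lborel. (if t \<le> x then H_fun k x else 0)) \<in> borel_measurable borel"
    by measurable
  moreover have "(\<lambda>t. LINT x|lborel. (if t \<le> x then H_fun k x else 0)) = H_fun (Suc k)"
    by (auto simp: fun_eq_iff set_lebesgue_integral_def intro!: Bochner_Integration.integral_cong)
  ultimately show ?case by simp
qed

lemma set_integral_Ici_eq_Ioi:
  fixes f :: "real \<Rightarrow> 'a::{banach, second_countable_topology}"
  assumes [measurable]: "f \<in> borel_measurable borel"
  shows "(LBINT x:{a..}. f x) = (LBINT x:{a<..}. f x)"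
  unfolding set_lebesgue_integral_def
proof (intro integral_cong_AE)
  show "AE x in lborel. indicator {a..} x *\<^sub>R f x = indicator {a<..} x *\<^sub>R f x"
    using AE_lborel_singleton[of a] by eventually_elim (auto simp: indicator_def)
qed auto

lemma set_integrable_inverse_square:
  assumes "t > 0"
  shows "set_integrable lborel {t..} (\<lambda>x::real. 1 / x\<^sup>2)"
proof -
  \<comment> \<open>The open half-line from t/2 contains the closed one from t and still stays away
    from the singularity.\<close>
  have "set_integrable lborel {t/2<..} (\<lambda>x::real. 1 / x\<^sup>2)"
  proof (rule FTC_Ioi_nonneg(1))
    show "DERIV (\<lambda>x. - 1 / x) x :> 1 / x\<^sup>2" if "t / 2 < x" for x
      using that assms by (auto intro!: derivative_eq_intros simp: power2_eq_square)
    show "((\<lambda>x. - 1 / x) \<longlongrightarrow> - 1 / (t/2)) (at_right (t/2))"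
      using assms by (intro tendsto_intros) auto
    show "((\<lambda>x::real. - 1 / x) \<longlongrightarrow> 0) at_top" by real_asymp
  qed (use assms in \<open>auto intro!: continuous_intros\<close>)
  then show ?thesis
    by (rule set_integrable_subset) (use assms in auto)
qed

text \<open>Writing 1/t^2 as a superposition of exponentials makes iterated tail integrals explicit,
  since integrating an exponential over a tail only divides it by its rate.\<close>

lemma laplace_inverse_square:
  assumes "t > 0"
  shows "set_integrable lborel {0<..} (\<lambda>s::real. s * exp (- (s * t)))"
    and "(LBINT s:{0<..}. s * exp (- (s * t))) = 1 / t\<^sup>2"
proof -
  let ?F = "\<lambda>s. - (s / t + 1 / t\<^sup>2) * exp (- (s * t))"
  have D: "DERIV ?F s :> s * exp (- (s * t))" for s
    using assms by (auto intro!: derivative_eq_intros simp: field_simps power2_eq_square)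
  have A: "(?F \<longlongrightarrow> ?F 0) (at_right 0)"
    using assms by (intro tendsto_intros) auto
  have B: "(?F \<longlongrightarrow> 0) at_top"
    using assms by real_asymp
  from FTC_Ioi_nonneg[OF D _ _ A B] show "set_integrable lborel {0<..} (\<lambda>s::real. s * exp (- (s * t)))"
    "(LBINT s:{0<..}. s * exp (- (s * t))) = 1 / t\<^sup>2"
    by (auto intro!: continuous_intros)
qed

text \<open>The repeated tail integrals of \<open>e\<^sup>-\<^sup>i\<^sup>w\<^sup>t/t\<^sup>2\<close>, written as Laplace transforms: since
  \<open>|s + iw| \<ge> 1\<close> for \<open>|w| \<ge> 1\<close>, dividing by powers of \<open>s + iw\<close> keeps the bound \<open>1/t\<^sup>2\<close>,
  whereas estimating the tail integrals directly loses a power of \<open>t\<close> each time.\<close>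

definition osc_laplace :: "real \<Rightarrow> nat \<Rightarrow> real \<Rightarrow> complex" where
  "osc_laplace w k t =
     (LBINT s:{0<..}. of_real s * exp (- (Complex s w * of_real t)) / Complex s w ^ k)"

lemma norm_osc_laplace_integrand:
  assumes "\<bar>w\<bar> \<ge> 1" "s \<ge> 0"
  shows "cmod (of_real s * exp (- (Complex s w * of_real t)) / Complex s w ^ k) \<le> s * exp (- (s * t))"
proof -
  have "1 \<le> cmod (Complex s w)"
    using abs_Im_le_cmod[of "Complex s w"] assms by simp
  then have "1 \<le> cmod (Complex s w) ^ k" by simp
  then have "s * exp (- (s * t)) / cmod (Complex s w) ^ k \<le> s * exp (- (s * t)) / 1"
    using assms by (intro divide_left_mono) auto
  then show ?thesis
    using assms by (simp add: norm_mult norm_divide norm_power)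
qed

lemma measurable_Complex_const [measurable]: "(\<lambda>s. Complex s w) \<in> borel_measurable borel"
  by (simp add: Complex_eq[abs_def] cong: measurable_cong)

text \<open>The bound on the integral of the modulus, stronger than the one on
  \<open>osc_laplace\<close> itself, is what justifies Fubini in the next recursion step.\<close>

lemma osc_laplace_bound:
  assumes "\<bar>w\<bar> \<ge> 1" "t > 0"
  shows "set_integrable lborel {0<..} (\<lambda>s. of_real s * exp (- (Complex s w * of_real t)) / Complex s w ^ k)"
    and "(LBINT s:{0<..}. cmod (of_real s * exp (- (Complex s w * of_real t)) / Complex s w ^ k)) \<le> 1 / t\<^sup>2"
    and "cmod (osc_laplace w k t) \<le> 1 / t\<^sup>2"
proof -
  show I: "set_integrable lborel {0<..} (\<lambda>s. of_real s * exp (- (Complex s w * of_real t)) / Complex s w ^ k)"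
    by (rule set_integrable_bound[OF laplace_inverse_square(1)[OF assms(2)]])
       (auto simp: set_borel_measurable_def norm_osc_laplace_integrand[OF assms(1)] simp del: norm_mult norm_divide
         intro!: AE_I2 order_trans[OF norm_osc_laplace_integrand[OF assms(1)]] )
  show N: "(LBINT s:{0<..}. cmod (of_real s * exp (- (Complex s w * of_real t)) / Complex s w ^ k)) \<le> 1 / t\<^sup>2"
    unfolding laplace_inverse_square(2)[OF assms(2), symmetric]
    by (rule set_integral_mono)
       (use set_integrable_norm[OF I] laplace_inverse_square(1)[OF assms(2)]
          norm_osc_laplace_integrand[OF assms(1)] in auto)
  show "cmod (osc_laplace w k t) \<le> 1 / t\<^sup>2"
    unfolding osc_laplace_def
    using set_integral_norm_bound[OF I] N by linarith
qed

lemma osc_laplace_0: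
  assumes "t > 0"
  shows "osc_laplace w 0 t = cis (- (w * t)) / of_real (t\<^sup>2)"
proof -
  have "of_real s * exp (- (Complex s w * of_real t)) = of_real (s * exp (- (s * t))) * cis (- (w * t))" for s
  proof -
    have "- (Complex s w * of_real t) = of_real (- (s * t)) + \<i> * of_real (- (w * t))"
      by (simp add: complex_eq_iff)
    then show ?thesis by (simp only: exp_add exp_of_real cis_conv_exp) (simp add: mult_ac)
  qed
  then have "osc_laplace w 0 t = (LBINT s:{0<..}. of_real (s * exp (- (s * t))) * cis (- (w * t)))"
    by (simp only: osc_laplace_def power_0 div_by_1)
  also have "\<dots> = (LBINT s:{0<..}. of_real (s * exp (- (s * t)))) * cis (- (w * t))"
    by (rule set_integral_mult_left)
  also have "(LBINT s:{0<..}. complex_of_real (s * exp (- (s * t)))) = of_real (1 / t\<^sup>2)"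
    by (simp only: set_integral_complex_of_real laplace_inverse_square(2)[OF assms])
  finally show ?thesis by simp
qed

lemma exp_tail_integral:
  assumes "s > 0"
  shows "(LBINT x:{t..}. exp (- (Complex s w * of_real x))) = exp (- (Complex s w * of_real t)) / Complex s w"
proof -
  have nz: "Complex s w \<noteq> 0" using assms by (auto simp: complex_eq_iff)
  have nrm: "cmod (exp (- (Complex s w * of_real x))) = exp (- (s * x))" for x
    by simp
  have "set_integrable lborel {t<..} (\<lambda>x. exp (- (s * x)))"
  proof (rule FTC_Ioi_nonneg(1))
    show "DERIV (\<lambda>x. - exp (- (s * x)) / s) x :> exp (- (s * x))" for x
      using assms by (auto intro!: derivative_eq_intros)
    show "((\<lambda>x. - exp (- (s * x)) / s) \<longlongrightarrow> - exp (- (s * t)) / s) (at_right t)"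
      using assms by (intro tendsto_intros) auto
    show "((\<lambda>x. - exp (- (s * x)) / s) \<longlongrightarrow> 0) at_top"
      using assms by real_asymp
  qed (auto intro!: continuous_intros)
  then have I: "set_integrable lborel {t<..} (\<lambda>x. exp (- (Complex s w * of_real x)))"
    by (rule set_integrable_bound) (auto simp: set_borel_measurable_def)
  have "(LBINT x:{t..}. exp (- (Complex s w * of_real x))) = (LBINT x:{t<..}. exp (- (Complex s w * of_real x)))"
    by (rule set_integral_Ici_eq_Ioi) measurable
  also have "\<dots> = 0 - (- (exp (- (Complex s w * of_real t)) / Complex s w))"
  proof (rule FTC_Ioi[OF _ _ I])
    show "((\<lambda>x. - (exp (- (Complex s w * of_real x)) / Complex s w)) has_vector_derivative
        exp (- (Complex s w * of_real x))) (at x)" for x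
      using nz by (auto intro!: derivative_eq_intros has_vector_derivative_real_field)
    show "((\<lambda>x. - (exp (- (Complex s w * of_real x)) / Complex s w)) \<longlongrightarrow>
        - (exp (- (Complex s w * of_real t)) / Complex s w)) (at_right t)"
      using nz by (intro tendsto_intros) auto
    have "((\<lambda>x. exp (- (s * x)) / cmod (Complex s w)) \<longlongrightarrow> 0) at_top"
      using assms nz by real_asymp
    then show "((\<lambda>x. - (exp (- (Complex s w * of_real x)) / Complex s w)) \<longlongrightarrow> 0) at_top"
      by (subst tendsto_norm_zero_iff[symmetric]) (simp add: norm_divide)
  qed (auto intro!: continuous_intros)
  finally show ?thesis by simp
qed

text \<open>By Fubini the tail integral passes inside the Laplace integral, where it contributes one
  more factor 1/(s + iw). Absolute integrability holds because the inner integrals of the modulus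
  are at most 1/x^2, which is integrable on x \<ge> t > 0.\<close>

lemma osc_laplace_Suc:
  assumes "\<bar>w\<bar> \<ge> 1" "t > 0"
  shows "set_integrable lborel {t..} (osc_laplace w k)"
    and "(LBINT x:{t..}. osc_laplace w k x) = osc_laplace w (Suc k) t"
proof -
  define f where "f = (\<lambda>x s. indicator {t..} x *\<^sub>R indicator {0<..} s *\<^sub>R
      (of_real s * exp (- (Complex s w * of_real x)) / Complex s w ^ k))"
  have [measurable]: "(\<lambda>(x, s). f x s) \<in> borel_measurable (lborel \<Otimes>\<^sub>M lborel)"
    unfolding f_def by measurable
  have fx: "f x = (\<lambda>s. indicator {t..} x *\<^sub>R indicator {0<..} s *\<^sub>R
      (of_real s * exp (- (Complex s w * of_real x)) / Complex s w ^ k))" for x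
    unfolding f_def ..
  have int: "integrable lborel (f x)" for x
    using osc_laplace_bound(1)[OF assms(1), of x k] assms(2)
    by (cases "x \<ge> t") (auto simp: fx set_integrable_def)
  have osc: "(LINT s|lborel. f x s) = indicator {t..} x *\<^sub>R osc_laplace w k x" for x
    unfolding fx osc_laplace_def set_lebesgue_integral_def by (rule integral_scaleR_right)
  have nrm: "(LINT s|lborel. norm (f x s)) \<le> indicator {t..} x *\<^sub>R (1 / x\<^sup>2)" for x
    using osc_laplace_bound(2)[OF assms(1), of x k] assms(2)
    by (cases "x \<ge> t") (auto simp: fx set_lebesgue_integral_def)
  have inv2: "integrable lborel (\<lambda>x. indicator {t..} x *\<^sub>R (1 / x\<^sup>2))"
    using set_integrable_inverse_square[OF assms(2)] by (simp add: set_integrable_def)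
  have prod: "integrable (lborel \<Otimes>\<^sub>M lborel) (\<lambda>(x, s). f x s)"
  proof (rule lborel_pair.Fubini_integrable)
    show "integrable lborel (\<lambda>x. LINT s|lborel. norm ((\<lambda>(x, s). f x s) (x, s)))"
      by (rule Bochner_Integration.integrable_bound[OF inv2])
         (use nrm in \<open>auto intro!: AE_I2\<close>)
  qed (use int in auto)
  have "integrable lborel (\<lambda>x. LINT s|lborel. f x s)"
    using lborel_pair.integrable_fst[OF prod] by simp
  then show "set_integrable lborel {t..} (osc_laplace w k)"
    by (simp add: osc set_integrable_def)
  have "(LBINT x:{t..}. osc_laplace w k x) = (LINT x|lborel. LINT s|lborel. f x s)"
    by (simp add: osc set_lebesgue_integral_def)
  also have "\<dots> = (LINT s|lborel. LINT x|lborel. f x s)"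
    by (rule lborel_pair.Fubini_integral[symmetric, OF prod])
  also have "\<dots> = osc_laplace w (Suc k) t"
    unfolding osc_laplace_def set_lebesgue_integral_def
  proof (intro Bochner_Integration.integral_cong refl)
    fix s :: real
    have "(LINT x|lborel. f x s) = (indicator {0<..} s *\<^sub>R (of_real s / Complex s w ^ k)) *
        (LBINT x:{t..}. exp (- (Complex s w * of_real x)))"
      unfolding f_def set_lebesgue_integral_def
      by (subst integral_mult_right_zero[symmetric]) (auto intro!: Bochner_Integration.integral_cong simp: indicator_def)
    also have "\<dots> = indicator {0<..} s *\<^sub>R
        (of_real s * exp (- (Complex s w * of_real t)) / Complex s w ^ Suc k)"
      by (cases "s > 0") (simp_all add: exp_tail_integral divide_simps)
    finally show "(LINT x|lborel. f x s) = indicator {0<..} s *\<^sub>R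
        (of_real s * exp (- (Complex s w * of_real t)) / Complex s w ^ Suc k)" .
  qed
  finally show "(LBINT x:{t..}. osc_laplace w k x) = osc_laplace w (Suc k) t" .
qed

text \<open>\<open>h_fun t\<close> is half the real part of
  \<open>cis (- t) - cis (- 2 * t)\<close>, so only the frequencies 1 and 2 occur, and both meet the
  condition |w| \<ge> 1 of the recursion.\<close>

lemma H_fun_eq_laplace:
  assumes "t > 0"
  shows "H_fun k t = Re (osc_laplace 1 k t - osc_laplace 2 k t) / 2"
  using assms
proof (induction k arbitrary: t)
  case 0
  then show ?case
    by (simp add: osc_laplace_0 h_fun_def divide_simps del: of_real_power)
next
  case (Suc k)
  have I: "set_integrable lborel {t..} (\<lambda>x. osc_laplace 1 k x - osc_laplace 2 k x)"
    by (intro set_integral_diff osc_laplace_Suc) (use Suc.prems in auto)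
  have "H_fun (Suc k) t = (LBINT x:{t..}. Re (osc_laplace 1 k x - osc_laplace 2 k x) / 2)"
    unfolding H_fun.simps by (intro set_lebesgue_integral_cong) (use Suc in auto)
  also have "\<dots> = (LBINT x:{t..}. Re (osc_laplace 1 k x - osc_laplace 2 k x)) / 2"
    by (rule set_integral_divide_zero)
  also have "(LBINT x:{t..}. Re (osc_laplace 1 k x - osc_laplace 2 k x)) =
      Re (LBINT x:{t..}. osc_laplace 1 k x - osc_laplace 2 k x)"
    using I unfolding set_integrable_def set_lebesgue_integral_def
    by (subst integral_Re[symmetric]) auto
  also have "(LBINT x:{t..}. osc_laplace 1 k x - osc_laplace 2 k x) =
      osc_laplace 1 (Suc k) t - osc_laplace 2 (Suc k) t"
    using Suc.prems by (simp add: set_integral_diff osc_laplace_Suc)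
  finally show ?case .
qed

lemma H_fun_decay:
  assumes "t > 0"
  shows "\<bar>H_fun k t\<bar> \<le> 1 / t\<^sup>2"
proof -
  have "\<bar>Re (osc_laplace 1 k t - osc_laplace 2 k t)\<bar> \<le> cmod (osc_laplace 1 k t) + cmod (osc_laplace 2 k t)"
    using abs_Re_le_cmod norm_triangle_ineq4 order_trans by blast
  also have "\<dots> \<le> 1 / t\<^sup>2 + 1 / t\<^sup>2"
    using assms by (intro add_mono osc_laplace_bound(3)) auto
  finally show ?thesis using H_fun_eq_laplace[OF assms, of k] by simp
qed

lemma set_integrable_H_fun_tail:
  assumes "t > 0"
  shows "set_integrable lborel {t..} (H_fun k)"
  by (rule set_integrable_bound[OF set_integrable_inverse_square[OF assms]])
     (use H_fun_decay[of _ k] assms in \<open>auto simp: set_borel_measurable_def\<close>)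

text \<open>The two claims are interleaved: boundedness near 0 and the quadratic decay make
  \<open>H_fun k\<close> integrable, and its integral norm then bounds
  \<open>H_fun (Suc k)\<close>.\<close>

lemma H_fun_Ioi:
  shows set_integrable_H_fun: "set_integrable lborel {0<..} (H_fun k)"
    and H_fun_bounded: "\<exists>c. \<forall>t>0. \<bar>H_fun k t\<bar> \<le> c"
proof -
  have int: "set_integrable lborel {0<..} (H_fun k)" if c: "\<And>t. t > 0 \<Longrightarrow> \<bar>H_fun k t\<bar> \<le> c" for c k
  proof -
    have "set_integrable lborel {0<..1::real} (\<lambda>_. c)"
      unfolding set_integrable_def by (rule integrable_scaleR_left) simp
    then have "set_integrable lborel {0<..1} (H_fun k)"
      by (rule set_integrable_bound) (auto simp: set_borel_measurable_def intro!: AE_I2 order_trans[OF c])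
    from set_integrable_Un[OF this set_integrable_H_fun_tail[of 1 k]]
    have "set_integrable lborel ({0<..1} \<union> {1..}) (H_fun k)" by simp
    also have "{0<..1} \<union> {1..} = {0::real<..}" by auto
    finally show ?thesis .
  qed
  show bdd: "\<exists>c. \<forall>t>0. \<bar>H_fun k t\<bar> \<le> c" for k
  proof (induction k)
    case 0
    show ?case
      using h_fun_bound by (intro exI[of _ "5 / 4"]) (auto simp: divide_simps)
  next
    case (Suc k)
    then have I: "set_integrable lborel {0<..} (H_fun k)" using int by blast
    show ?case
    proof (intro exI allI impI)
      fix t :: real assume t: "t > 0"
      have "\<bar>H_fun (Suc k) t\<bar> \<le> (LBINT x:{t..}. \<bar>H_fun k x\<bar>)"
        using set_integral_norm_bound[OF set_integrable_H_fun_tail[OF t, of k]] by simp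
      also have "\<dots> \<le> (LBINT x:{0<..}. \<bar>H_fun k x\<bar>)"
        unfolding set_lebesgue_integral_def
      proof (rule integral_mono)
        show "integrable lborel (\<lambda>x. indicator {t..} x *\<^sub>R \<bar>H_fun k x\<bar>)"
          "integrable lborel (\<lambda>x. indicator {0<..} x *\<^sub>R \<bar>H_fun k x\<bar>)"
          using set_integrable_abs[OF I] set_integrable_abs[OF set_integrable_H_fun_tail[OF t]]
          by (simp_all add: set_integrable_def)
      qed (use t in \<open>auto simp: indicator_def\<close>)
      finally show "\<bar>H_fun (Suc k) t\<bar> \<le> (LBINT x:{0<..}. \<bar>H_fun k x\<bar>)" .
    qed
  qed
  then show "set_integrable lborel {0<..} (H_fun k)" using int by blast
qed

section \<open>Transforms of all kernels by integration by parts\<close>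

text \<open>Continuity of \<open>H_fun k\<close> gives the derivative of
  \<open>H_fun (Suc k)\<close>, and that in turn its continuity, so the induction runs over
  continuity alone.\<close>

lemma H_fun_deriv:
  "t > 0 \<Longrightarrow> isCont (H_fun k) t"
  "t > 0 \<Longrightarrow> DERIV (H_fun (Suc k)) t :> - H_fun k t"
proof -
  have D: "DERIV (H_fun (Suc k)) t :> - H_fun k t"
    if C: "\<And>t. t > 0 \<Longrightarrow> isCont (H_fun k) t" and t: "t > 0" for k t
  proof -
    \<comment> \<open>A base point between 0 and t: above it, the tail integral is a constant minus
      an integral over a compact interval, to which the fundamental theorem applies.\<close>
    define a where "a = t / 2"
    have a: "a > 0" "a < t" using t by (auto simp: a_def)
    have eq: "H_fun (Suc k) u = H_fun (Suc k) a - (LBINT x=a..u. H_fun k x)" if u: "u \<ge> a" for u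
    proof -
      have H: "H_fun (Suc k) u = (LBINT x=u..\<infinity>. H_fun k x)" for u
        by (simp add: interval_lebesgue_integral_def set_integral_Ici_eq_Ioi)
      have "interval_lebesgue_integrable lborel (ereal a) \<infinity> (H_fun k)"
        using set_integrable_H_fun_tail[OF a(1), of k]
        by (auto simp: interval_lebesgue_integrable_def intro: set_integrable_subset)
      then have "(LBINT x=a..u. H_fun k x) + (LBINT x=u..\<infinity>. H_fun k x) = (LBINT x=a..\<infinity>. H_fun k x)"
        using u by (intro interval_integral_sum) (simp add: min_def max_def)
      then show ?thesis unfolding H by simp
    qed
    have "((\<lambda>u. LBINT x=a..u. H_fun k x) has_vector_derivative H_fun k t) (at t within {a..2 * t})"
      using a C by (intro interval_integral_FTC2) (auto intro!: continuous_at_imp_continuous_on)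
    then have "((\<lambda>u. LBINT x=a..u. H_fun k x) has_real_derivative H_fun k t) (at t within {a<..<2 * t})"
      by (auto simp: has_real_derivative_iff_has_vector_derivative intro: has_vector_derivative_within_subset)
    then have "DERIV (\<lambda>u. LBINT x=a..u. H_fun k x) t :> H_fun k t"
      using a by (simp add: at_within_open[of t "{a<..<2 * t}"])
    then have "DERIV (\<lambda>u. H_fun (Suc k) a - (LBINT x=a..u. H_fun k x)) t :> 0 - H_fun k t"
      by (intro DERIV_diff DERIV_const)
    moreover have "eventually (\<lambda>u. u \<in> {a<..}) (nhds t)"
      using a by (intro eventually_nhds_in_open) auto
    then have ev: "eventually (\<lambda>u. H_fun (Suc k) u = H_fun (Suc k) a - (LBINT x=a..u. H_fun k x)) (nhds t)"
      by eventually_elim (rule eq, simp)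
    ultimately have "DERIV (H_fun (Suc k)) t :> 0 - H_fun k t"
      by (simp only: DERIV_cong_ev[OF refl ev refl])
    then show ?thesis by simp
  qed
  have C: "\<forall>t>0. isCont (H_fun k) t" for k
  proof (induction k)
    case 0
    show ?case by (auto simp: h_fun_def intro!: continuous_intros)
  next
    case (Suc k)
    then show ?case by (intro allI impI DERIV_isCont[OF D]) simp_all
  qed
  show "t > 0 \<Longrightarrow> isCont (H_fun k) t" using C[of k] by simp
  show "t > 0 \<Longrightarrow> DERIV (H_fun (Suc k)) t :> - H_fun k t" by (rule D) (use C[of k] in auto)
qed

lemma set_integrable_bounded_mult_H_fun:
  assumes [measurable]: "u \<in> borel_measurable borel" and "\<And>t. t > 0 \<Longrightarrow> \<bar>u t\<bar> \<le> B"
  shows "set_integrable lborel {0<..} (\<lambda>t. u t * H_fun k t)"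
proof (rule set_integrable_bound)
  show "set_integrable lborel {0<..} (\<lambda>t. B * H_fun k t)"
    using set_integrable_H_fun by simp
  show "AE t in lborel. t \<in> {0<..} \<longrightarrow> norm (u t * H_fun k t) \<le> norm (B * H_fun k t)"
  proof (intro AE_I2 impI)
    fix t :: real assume "t \<in> {0<..}"
    then have "\<bar>u t\<bar> \<le> \<bar>B\<bar>" using assms(2)[of t] by simp
    then show "norm (u t * H_fun k t) \<le> norm (B * H_fun k t)"
      by (simp add: abs_mult mult_right_mono)
  qed
qed (simp add: set_borel_measurable_def)

text \<open>Both boundary terms vanish, for different reasons: at 0 because u tends to 0 and the
  kernel is bounded, at infinity because u is bounded and the kernel decays.\<close>

lemma H_fun_integral_by_parts:
  fixes u v :: "real \<Rightarrow> real"
  assumes [measurable]: "u \<in> borel_measurable borel" "v \<in> borel_measurable borel"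
    and D: "\<And>t. t > 0 \<Longrightarrow> DERIV u t :> v t" and v: "\<And>t. t > 0 \<Longrightarrow> isCont v t"
    and bd: "\<And>t. t > 0 \<Longrightarrow> \<bar>u t\<bar> \<le> B" "\<And>t. t > 0 \<Longrightarrow> \<bar>v t\<bar> \<le> B'"
    and lim: "(u \<longlongrightarrow> 0) (at_right 0)"
  shows "(LBINT t:{0<..}. v t * H_fun (Suc k) t) = (LBINT t:{0<..}. u t * H_fun k t)"
proof -
  note I = set_integrable_bounded_mult_H_fun[OF assms(2) bd(2), of "Suc k"]
    set_integrable_bounded_mult_H_fun[OF assms(1) bd(1), of k]
  obtain c where c: "\<And>t. t > 0 \<Longrightarrow> \<bar>H_fun (Suc k) t\<bar> \<le> c" using H_fun_bounded by blast
  have "(LBINT t:{0<..}. v t * H_fun (Suc k) t - u t * H_fun k t) = 0 - 0"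
  proof (rule FTC_Ioi)
    show "((\<lambda>t. u t * H_fun (Suc k) t) has_vector_derivative v t * H_fun (Suc k) t - u t * H_fun k t) (at t)"
      if "t > 0" for t
      using DERIV_mult[OF D[OF that] H_fun_deriv(2)[OF that, of k]]
      by (simp add: has_real_derivative_iff_has_vector_derivative algebra_simps)
    show "isCont (\<lambda>t. v t * H_fun (Suc k) t - u t * H_fun k t) t" if "t > 0" for t
      by (intro isCont_diff isCont_mult H_fun_deriv(1) v DERIV_isCont[OF D] that)
    show "set_integrable lborel {0<..} (\<lambda>t. v t * H_fun (Suc k) t - u t * H_fun k t)"
      by (intro set_integral_diff I)
    have "((\<lambda>t. c * \<bar>u t\<bar>) \<longlongrightarrow> c * \<bar>0\<bar>) (at_right 0)" by (intro tendsto_intros lim)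
    then have lim0: "((\<lambda>t. c * \<bar>u t\<bar>) \<longlongrightarrow> 0) (at_right 0)" by simp
    have "eventually (\<lambda>t. norm (u t * H_fun (Suc k) t) \<le> c * \<bar>u t\<bar>) (at_right 0)"
      using eventually_at_right_less[of 0]
    proof eventually_elim
      case (elim t)
      show ?case using mult_right_mono[OF c[OF elim], of "\<bar>u t\<bar>"] by (simp add: abs_mult mult.commute del: H_fun.simps)
    qed
    from this lim0 show "((\<lambda>t. u t * H_fun (Suc k) t) \<longlongrightarrow> 0) (at_right 0)"
      by (rule Lim_null_comparison)
    have lim1: "((\<lambda>t::real. \<bar>B\<bar> / t\<^sup>2) \<longlongrightarrow> 0) at_top" by real_asymp
    have "eventually (\<lambda>t. norm (u t * H_fun (Suc k) t) \<le> \<bar>B\<bar> / t\<^sup>2) at_top"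
      using eventually_gt_at_top[of 0]
    proof eventually_elim
      case (elim t)
      have "\<bar>u t\<bar> * \<bar>H_fun (Suc k) t\<bar> \<le> \<bar>B\<bar> * (1 / t\<^sup>2)"
        using elim bd(1)[OF elim] by (intro mult_mono H_fun_decay) auto
      then show ?case by (simp add: abs_mult)
    qed
    from this lim1 show "((\<lambda>t. u t * H_fun (Suc k) t) \<longlongrightarrow> 0) at_top"
      by (rule Lim_null_comparison)
  qed
  then show ?thesis using I by (simp add: set_integral_diff)
qed

text \<open>Each integration by parts exchanges sine and cosine, so the parity of the order selects
  the function.\<close>

definition trig :: "nat \<Rightarrow> real \<Rightarrow> real" where
  "trig k = (if even k then cos else sin)"

lemma trig_props [simp]: "\<bar>trig k t\<bar> \<le> 1" "trig k \<in> borel_measurable borel"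
  by (simp_all add: trig_def)

definition H_transform :: "nat \<Rightarrow> real \<Rightarrow> real" where
  "H_transform k x = (LBINT t:{0<..}. trig k (x * t) * H_fun k t)"

text \<open>The multiplier of de la Vallee Poussin's kernel, in the form in which the four absolute
  values come out of \<open>H_fun_0_cos_transform\<close>.\<close>

definition trapezoid :: "real \<Rightarrow> real" where
  "trapezoid x = (\<bar>x + 2\<bar> + \<bar>x - 2\<bar> - \<bar>x + 1\<bar> - \<bar>x - 1\<bar>) / 2"

lemma trapezoid_eq_1: "0 \<le> x \<Longrightarrow> x \<le> 1 \<Longrightarrow> trapezoid x = 1"
  and trapezoid_eq_0: "x \<ge> 2 \<Longrightarrow> trapezoid x = 0"
  by (simp_all add: trapezoid_def)

lemma H_transform_0: "H_transform 0 x = pi / 4 * trapezoid x"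
  using H_fun_0_cos_transform[of x] by (simp add: H_transform_def trig_def trapezoid_def)

text \<open>The primitive of the trigonometric factor has to vanish at t = 0. For the sine this
  forces (1 - cos(xt))/x, whose constant 1 leaves the term \<open>H_transform k 0\<close>; for the
  cosine, sin(xt)/x vanishes by itself.\<close>

lemma H_transform_Suc:
  assumes "x > 0"
  shows "even k \<Longrightarrow> H_transform (Suc k) x = (H_transform k 0 - H_transform k x) / x"
    and "odd k \<Longrightarrow> H_transform (Suc k) x = H_transform k x / x"
proof -
  assume k: "even k"
  have I: "set_integrable lborel {0<..} (\<lambda>t. cos (x * t) * H_fun k t)"
    by (rule set_integrable_bounded_mult_H_fun[where B = 1]) auto
  have "(LBINT t:{0<..}. sin (x * t) * H_fun (Suc k) t) =
      (LBINT t:{0<..}. (1 - cos (x * t)) / x * H_fun k t)"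
  proof (rule H_fun_integral_by_parts[where B = "2 / x" and B' = 1])
    show "\<bar>(1 - cos (x * t)) / x\<bar> \<le> 2 / x" for t
      using assms cos_ge_minus_one[of "x * t"] by (auto simp: abs_divide divide_simps)
    have "((\<lambda>t. (1 - cos (x * t)) / x) \<longlongrightarrow> (1 - cos (x * 0)) / x) (at_right 0)"
      using assms by (intro tendsto_intros) auto
    then show "((\<lambda>t. (1 - cos (x * t)) / x) \<longlongrightarrow> 0) (at_right 0)" by simp
  qed (use assms in \<open>auto intro!: derivative_eq_intros continuous_intros\<close>)
  also have "\<dots> = (LBINT t:{0<..}. (H_fun k t - cos (x * t) * H_fun k t) / x)"
    by (simp add: algebra_simps)
  also have "\<dots> = ((LBINT t:{0<..}. H_fun k t) - (LBINT t:{0<..}. cos (x * t) * H_fun k t)) / x"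
    by (simp add: set_integral_diff I set_integrable_H_fun)
  finally show "H_transform (Suc k) x = (H_transform k 0 - H_transform k x) / x"
    using k by (simp add: H_transform_def trig_def del: H_fun.simps)
next
  assume k: "odd k"
  have "(LBINT t:{0<..}. cos (x * t) * H_fun (Suc k) t) = (LBINT t:{0<..}. sin (x * t) / x * H_fun k t)"
  proof (rule H_fun_integral_by_parts[where B = "1 / x" and B' = 1])
    show "\<bar>sin (x * t) / x\<bar> \<le> 1 / x" for t
      using assms by (auto simp: abs_divide divide_simps)
    have "((\<lambda>t. sin (x * t) / x) \<longlongrightarrow> sin (x * 0) / x) (at_right 0)"
      using assms by (intro tendsto_intros) auto
    then show "((\<lambda>t. sin (x * t) / x) \<longlongrightarrow> 0) (at_right 0)" by simp
  qed (use assms in \<open>auto intro!: derivative_eq_intros continuous_intros\<close>)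
  also have "\<dots> = (LBINT t:{0<..}. sin (x * t) * H_fun k t) / x"
    by simp
  finally show "H_transform (Suc k) x = H_transform k x / x"
    using k by (simp add: H_transform_def trig_def del: H_fun.simps)
qed

text \<open>The closed formula for the transform divides by powers of x and says nothing at 0. The
  value there, needed in the recursion, is obtained as a limit along points of (0,1], where the
  trapezoid is 1.\<close>

lemma H_transform_continuous_at_0:
  "(\<lambda>i. H_transform k (1 / real (i + 2))) \<longlonglongrightarrow> H_transform k 0"
  unfolding H_transform_def set_lebesgue_integral_def
proof (rule integral_dominated_convergence[where w = "\<lambda>t. indicator {0<..} t *\<^sub>R \<bar>H_fun k t\<bar>"])
  show "integrable lborel (\<lambda>t. indicator {0<..} t *\<^sub>R \<bar>H_fun k t\<bar>)"
    using set_integrable_abs[OF set_integrable_H_fun[of k]] by (simp add: set_integrable_def)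
  have "(\<lambda>i. trig k (1 / real (i + 2) * t)) \<longlonglongrightarrow> trig k (0 * t)" for t
  proof -
    have "(\<lambda>i. 1 / real (i + 2)) \<longlonglongrightarrow> 0" by real_asymp
    then have "(\<lambda>i. 1 / real (i + 2) * t) \<longlonglongrightarrow> 0 * t" by (rule tendsto_mult_right)
    from tendsto_sin[OF this] tendsto_cos[OF this] show ?thesis
      unfolding trig_def by (cases "even k") simp_all
  qed
  then show "AE t in lborel. (\<lambda>i. indicator {0<..} t *\<^sub>R (trig k (1 / real (i + 2) * t) * H_fun k t))
      \<longlonglongrightarrow> indicator {0<..} t *\<^sub>R (trig k (0 * t) * H_fun k t)"
    by (intro AE_I2 tendsto_intros)
  show "AE t in lborel. norm (indicator {0<..} t *\<^sub>R (trig k (1 / real (i + 2) * t) * H_fun k t))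
      \<le> indicator {0<..} t *\<^sub>R \<bar>H_fun k t\<bar>" for i
    using mult_right_mono[OF trig_props(1) abs_ge_zero]
    by (intro AE_I2) (auto simp: indicator_def abs_mult)
qed (auto simp: trig_def)

lemma H_transform_eq_aux:
  assumes "x > 0"
  shows "H_transform (2 * j + 1) x = (-1) ^ j * (pi / 4) * (1 - trapezoid x) / x ^ (2 * j + 1)"
    and "H_transform (2 * j + 2) x = (-1) ^ j * (pi / 4) * (1 - trapezoid x) / x ^ (2 * j + 2)"
  using assms
proof (induction j arbitrary: x)
  case 0
  {
    case 1
    then show ?case
      using H_transform_Suc(1)[of x 0] by (simp add: H_transform_0 trapezoid_def) (simp add: field_simps)
  }
  note * = this
  {
    case 2
    then show ?case using H_transform_Suc(2)[of x 1] *[of x] by (simp add: power2_eq_square)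
  }
next
  case (Suc j)
  \<comment> \<open>The transform of even order vanishes on (0,1], hence by continuity at 0. The
    recursion thus reduces to minus the transform divided by x, which is the source of the
    alternating sign. Order 0 differs: its value at 0 is pi/4.\<close>
  have "H_transform (2 * j + 2) (1 / real (i + 2)) = 0" for i
  proof -
    have "1 / real (i + 2) \<le> 1" by simp
    then have "trapezoid (1 / real (i + 2)) = 1"
      by (intro trapezoid_eq_1) simp_all
    then show ?thesis using Suc.IH(2)[of "1 / real (i + 2)"] by simp
  qed
  then have "(\<lambda>i. 0) \<longlonglongrightarrow> H_transform (2 * j + 2) 0"
    using H_transform_continuous_at_0[of "2 * j + 2"] by simp
  then have "H_transform (2 * j + 2) 0 = 0"
    by (simp add: LIMSEQ_const_iff)
  note z = this
  have *: "H_transform (2 * Suc j + 1) x = (-1) ^ Suc j * (pi / 4) * (1 - trapezoid x) / x ^ (2 * Suc j + 1)"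
    if "x > 0" for x
  proof -
    have "H_transform (Suc (2 * j + 2)) x = - ((-1) ^ j * (pi / 4) * (1 - trapezoid x) / x ^ (2 * j + 2)) / x"
      using H_transform_Suc(1)[OF that, of "2 * j + 2"] Suc.IH(2)[OF that] z by simp
    also have "\<dots> = (-1) ^ Suc j * (pi / 4) * (1 - trapezoid x) / (x * x ^ (2 * j + 2))" by simp
    finally show ?thesis by simp
  qed
  {
    case 1
    then show ?case using * by blast
  next
    case 2
    have "H_transform (Suc (2 * Suc j + 1)) x = (-1) ^ Suc j * (pi / 4) * (1 - trapezoid x) / x ^ (2 * Suc j + 1) / x"
      using *[OF 2] H_transform_Suc(2)[OF 2, of "2 * Suc j + 1"] by simp
    also have "\<dots> = (-1) ^ Suc j * (pi / 4) * (1 - trapezoid x) / (x * x ^ (2 * Suc j + 1))" by simp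
    finally show ?case by simp
  }
qed

lemma H_transform_eq:
  assumes "x > 0" "k \<ge> 1"
  shows "H_transform k x = (-1) ^ ((k - 1) div 2) * (pi / 4) * (1 - trapezoid x) / x ^ k"
proof (cases "even k")
  case True
  then obtain i where i: "k = 2 * i" by (rule evenE)
  then obtain j where "i = Suc j" using assms(2) by (cases i) auto
  then have "k = 2 * j + 2" using i by simp
  then show ?thesis using H_transform_eq_aux(2)[OF assms(1), of j] by simp
next
  case False
  then obtain j where "k = 2 * j + 1" by (rule oddE)
  then show ?thesis using H_transform_eq_aux(1)[OF assms(1), of j] by simp
qed

lemma C_const_eq: "C_const k = 4 / pi * (LBINT t:{0<..}. \<bar>H_fun k t\<bar>)"
  unfolding C_const_def by (subst set_integral_Ici_eq_Ioi) simp_all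

lemma H_transform_le: "\<bar>H_transform k x\<bar> \<le> pi / 4 * C_const k"
proof -
  have I: "set_integrable lborel {0<..} (\<lambda>t. trig k (x * t) * H_fun k t)"
    by (rule set_integrable_bounded_mult_H_fun[where B = 1]) (auto simp: trig_def)
  have "\<bar>H_transform k x\<bar> \<le> (LBINT t:{0<..}. \<bar>trig k (x * t) * H_fun k t\<bar>)"
    unfolding H_transform_def using set_integral_norm_bound[OF I] by simp
  also have "\<dots> \<le> (LBINT t:{0<..}. \<bar>H_fun k t\<bar>)"
    by (rule set_integral_mono)
       (use set_integrable_abs[OF I] set_integrable_abs[OF set_integrable_H_fun]
          mult_right_mono[OF trig_props(1) abs_ge_zero] in \<open>auto simp: abs_mult\<close>)
  also have "\<dots> = pi / 4 * C_const k" by (simp add: C_const_eq)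
  finally show ?thesis .
qed

text \<open>At x = 0 the transform is pi/4, and an integral never exceeds the integral of the
  modulus.\<close>

lemma C_const_0_ge_1: "C_const 0 \<ge> 1"
  using H_transform_le[of 0 0] H_transform_0[of 0] by (simp add: trapezoid_def)

text \<open>For k > 0 the transform is nonzero at x = 2, where the trapezoid has dropped to 0.
  Strict positivity is wanted because the norm estimates are stated for positive radii.\<close>

lemma C_const_pos: "C_const k > 0"
proof (cases "k = 0")
  case True
  then show ?thesis using C_const_0_ge_1 by simp
next
  case False
  have "0 < \<bar>H_transform k 2\<bar>"
    using H_transform_eq[of 2 k] False by (simp add: trapezoid_def abs_mult)
  then have "0 < pi / 4 * C_const k" using H_transform_le[of k 2] by linarith
  then show ?thesis by (simp add: zero_less_mult_iff)
qed

section \<open>Norms of Taylor multipliers\<close>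

text \<open>Seen as a product measure, the plane admits shears that are one-dimensional translations
  on every line parallel to an axis.\<close>

lemma lborel_complex_eq_distr:
  "(lborel :: complex measure) = distr (lborel \<Otimes>\<^sub>M lborel) borel (\<lambda>(x, y). Complex x y)"
proof (rule lborel_eqI)
  have [measurable]: "(\<lambda>(x, y). Complex x y) \<in> borel_measurable (lborel \<Otimes>\<^sub>M lborel)"
    by (simp add: Complex_eq case_prod_beta')
  fix l u :: complex
  assume le: "\<And>b. b \<in> Basis \<Longrightarrow> l \<bullet> b \<le> u \<bullet> b"
  have "(\<lambda>(x, y). Complex x y) -` box l u = box (Re l) (Re u) \<times> box (Im l) (Im u)"
    by (auto simp: in_box_complex_iff box_real)
  then have "emeasure (distr (lborel \<Otimes>\<^sub>M lborel) borel (\<lambda>(x, y). Complex x y)) (box l u) =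
      emeasure (lborel \<Otimes>\<^sub>M lborel) (box (Re l) (Re u) \<times> box (Im l) (Im u))"
    by (simp add: emeasure_distr space_pair_measure)
  also have "\<dots> = ennreal (Re u - Re l) * ennreal (Im u - Im l)"
    using le[of 1] le[of \<i>]
    by (subst lborel.emeasure_pair_measure_Times) (auto simp: Basis_complex_def)
  also have "\<dots> = (\<Prod>b\<in>Basis. (u - l) \<bullet> b)"
    using le[of 1] le[of \<i>] by (simp add: Basis_complex_def ennreal_mult)
  finally show "emeasure (distr (lborel \<Otimes>\<^sub>M lborel) borel (\<lambda>(x, y). Complex x y)) (box l u)
      = (\<Prod>b\<in>Basis. (u - l) \<bullet> b)" .
qed simp

lemma nn_integral_lborel_complex:
  fixes f :: "complex \<Rightarrow> ennreal"
  assumes [measurable]: "f \<in> borel_measurable borel"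
  shows "(\<integral>\<^sup>+z. f z \<partial>lborel) = (\<integral>\<^sup>+x. \<integral>\<^sup>+y. f (Complex x y) \<partial>lborel \<partial>lborel)"
    and "(\<integral>\<^sup>+z. f z \<partial>lborel) = (\<integral>\<^sup>+y. \<integral>\<^sup>+x. f (Complex x y) \<partial>lborel \<partial>lborel)"
proof -
  have [measurable]: "(\<lambda>(x, y). Complex x y) \<in> borel_measurable (lborel \<Otimes>\<^sub>M lborel)"
    by (simp add: Complex_eq case_prod_beta')
  have m: "(\<lambda>(x, y). f (Complex x y)) \<in> borel_measurable (lborel \<Otimes>\<^sub>M lborel)"
    using measurable_compose[OF \<open>(\<lambda>(x, y). Complex x y) \<in> _\<close> assms] by (simp add: case_prod_beta')
  have "(\<integral>\<^sup>+z. f z \<partial>lborel) = (\<integral>\<^sup>+w. f (case w of (x, y) \<Rightarrow> Complex x y) \<partial>(lborel \<Otimes>\<^sub>M lborel))"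
    by (subst lborel_complex_eq_distr) (simp add: nn_integral_distr)
  also have "\<dots> = (\<integral>\<^sup>+x. \<integral>\<^sup>+y. f (Complex x y) \<partial>lborel \<partial>lborel)"
    using lborel.nn_integral_fst[OF m] by (simp add: case_prod_beta')
  finally show "(\<integral>\<^sup>+z. f z \<partial>lborel) = (\<integral>\<^sup>+x. \<integral>\<^sup>+y. f (Complex x y) \<partial>lborel \<partial>lborel)" .
  also have "\<dots> = (\<integral>\<^sup>+y. \<integral>\<^sup>+x. f (Complex x y) \<partial>lborel \<partial>lborel)"
    by (rule lborel_pair.Fubini'[symmetric]) (use m in simp)
  finally show "(\<integral>\<^sup>+z. f z \<partial>lborel) = (\<integral>\<^sup>+y. \<integral>\<^sup>+x. f (Complex x y) \<partial>lborel \<partial>lborel)" .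
qed

lemma nn_integral_shear:
  fixes f :: "complex \<Rightarrow> ennreal"
  assumes [measurable]: "f \<in> borel_measurable borel"
  shows "(\<integral>\<^sup>+z. f (z + of_real (t * Im z)) \<partial>lborel) = (\<integral>\<^sup>+z. f z \<partial>lborel)"
    and "(\<integral>\<^sup>+z. f (z + \<i> * of_real (t * Re z)) \<partial>lborel) = (\<integral>\<^sup>+z. f z \<partial>lborel)"
proof -
  have [measurable]: "(\<lambda>x. f (Complex x y)) \<in> borel_measurable borel"
    "(\<lambda>x. f (Complex y x)) \<in> borel_measurable borel" for y
    by (simp_all add: Complex_eq)
  have "(\<integral>\<^sup>+z. f (z + of_real (t * Im z)) \<partial>lborel) =
      (\<integral>\<^sup>+y. \<integral>\<^sup>+x. f (Complex (t * y + 1 * x) y) \<partial>lborel \<partial>lborel)"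
    by (subst nn_integral_lborel_complex(2)) (simp_all add: Complex_eq algebra_simps)
  also have "\<dots> = (\<integral>\<^sup>+y. \<integral>\<^sup>+x. f (Complex x y) \<partial>lborel \<partial>lborel)"
    using nn_integral_real_affine[of "\<lambda>x. f (Complex x y)" 1 "t * y" for y] by simp
  finally show "(\<integral>\<^sup>+z. f (z + of_real (t * Im z)) \<partial>lborel) = (\<integral>\<^sup>+z. f z \<partial>lborel)"
    by (simp add: nn_integral_lborel_complex(2))
  have "(\<integral>\<^sup>+z. f (z + \<i> * of_real (t * Re z)) \<partial>lborel) =
      (\<integral>\<^sup>+y. \<integral>\<^sup>+x. f (Complex y (t * y + 1 * x)) \<partial>lborel \<partial>lborel)"
    by (subst nn_integral_lborel_complex(1)) (simp_all add: Complex_eq algebra_simps)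
  also have "\<dots> = (\<integral>\<^sup>+y. \<integral>\<^sup>+x. f (Complex y x) \<partial>lborel \<partial>lborel)"
    using nn_integral_real_affine[of "\<lambda>x. f (Complex y x)" 1 "t * y" for y] by simp
  finally show "(\<integral>\<^sup>+z. f (z + \<i> * of_real (t * Re z)) \<partial>lborel) = (\<integral>\<^sup>+z. f z \<partial>lborel)"
    by (simp add: nn_integral_lborel_complex(1))
qed

text \<open>A rotation by \<open>\<theta> \<noteq> \<pi>\<close> is a product of three shears.\<close>

lemma nn_integral_lborel_rotation:
  fixes f :: "complex \<Rightarrow> ennreal"
  assumes [measurable]: "f \<in> borel_measurable borel"
  shows "(\<integral>\<^sup>+z. f (cis \<theta> * z) \<partial>lborel) = (\<integral>\<^sup>+z. f z \<partial>lborel)"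
proof -
  have main: "(\<integral>\<^sup>+z. f (cis \<theta> * z) \<partial>lborel) = (\<integral>\<^sup>+z. f z \<partial>lborel)"
    if [measurable]: "f \<in> borel_measurable borel" and nz: "cos (\<theta> / 2) \<noteq> 0" for \<theta> and f :: "complex \<Rightarrow> ennreal"
  proof -
    \<comment> \<open>A horizontal shear by t, a vertical one by sin \<theta> and the same
      horizontal one again; comparing matrix entries forces 1 + t sin \<theta> = cos \<theta>, that
      is, this t.\<close>
    define t where "t = - tan (\<theta> / 2)"
    define X Y where "X = (\<lambda>z. z + of_real (t * Im z))"
      and "Y = (\<lambda>z. z + \<i> * of_real (sin \<theta> * Re z))"
    have [measurable]: "X \<in> borel_measurable borel" "Y \<in> borel_measurable borel"
      unfolding X_def Y_def by measurable
    have s: "sin \<theta> = 2 * sin (\<theta> / 2) * cos (\<theta> / 2)" using sin_double[of "\<theta> / 2"] by simp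
    have c: "cos \<theta> = 2 * (cos (\<theta> / 2))\<^sup>2 - 1" using cos_double_cos[of "\<theta> / 2"] by simp
    have ts: "1 + t * sin \<theta> = cos \<theta>"
      using nz sin_squared_eq[of "\<theta> / 2"] by (simp add: t_def s c tan_def power2_eq_square)
    have "t * (1 + cos \<theta>) = - sin \<theta>"
      using nz by (simp add: t_def s c tan_def power2_eq_square)
    then have ts2: "t + t * cos \<theta> = - sin \<theta>" by (simp add: algebra_simps)
    have "cis \<theta> * z = X (Y (X z))" for z
    proof (rule complex_eqI)
      have "Re (X (Y (X z))) = Re z * (1 + t * sin \<theta>) + Im z * (t + t * (1 + t * sin \<theta>))"
        by (simp add: X_def Y_def algebra_simps)
      then show "Re (cis \<theta> * z) = Re (X (Y (X z)))" unfolding ts ts2 by simp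
      have "Im (X (Y (X z))) = Re z * sin \<theta> + Im z * (1 + t * sin \<theta>)"
        by (simp add: X_def Y_def algebra_simps)
      then show "Im (cis \<theta> * z) = Im (X (Y (X z)))" unfolding ts by simp
    qed
    then have "(\<integral>\<^sup>+z. f (cis \<theta> * z) \<partial>lborel) = (\<integral>\<^sup>+z. (\<lambda>w. f (X (Y w))) (X z) \<partial>lborel)" by simp
    also have "\<dots> = (\<integral>\<^sup>+z. (\<lambda>w. f (X w)) (Y z) \<partial>lborel)"
      unfolding X_def[of ] by (subst nn_integral_shear(1)) (auto simp flip: X_def)
    also have "\<dots> = (\<integral>\<^sup>+z. f (X z) \<partial>lborel)"
      unfolding Y_def by (rule nn_integral_shear(2)) measurable
    also have "\<dots> = (\<integral>\<^sup>+z. f z \<partial>lborel)"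
      unfolding X_def by (rule nn_integral_shear(1)) measurable
    finally show ?thesis .
  qed
  show ?thesis
  proof (cases "cos (\<theta> / 2) = 0")
    case True
    \<comment> \<open>In the excluded case the tangent is infinite; the half-turn is performed as
      two quarter-turns.\<close>
    then have "cis \<theta> = -1"
      using sin_double[of "\<theta> / 2"] cos_double_cos[of "\<theta> / 2"] by (simp add: complex_eq_iff)
    then have "(\<integral>\<^sup>+z. f (cis \<theta> * z) \<partial>lborel) = (\<integral>\<^sup>+z. (\<lambda>w. f (cis (pi / 2) * w)) (cis (pi / 2) * z) \<partial>lborel)"
      by (simp add: cis_pi_half flip: mult.assoc)
    also have "\<dots> = (\<integral>\<^sup>+z. f (cis (pi / 2) * z) \<partial>lborel)"
      by (rule main) (measurable, simp add: cos_45)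
    also have "\<dots> = (\<integral>\<^sup>+z. f z \<partial>lborel)"
      by (rule main) (measurable, simp add: cos_45)
    finally show ?thesis .
  qed (use main in auto)
qed

section \<open>The weighted measure on the disc\<close>

text \<open>The indicator moves the restriction to the disc into the density, so that rotations and
  Tonelli's theorem can be applied with \<open>lborel\<close> on the whole plane.\<close>

definition bergman_weight :: "real \<Rightarrow> complex \<Rightarrow> ennreal" where
  "bergman_weight \<alpha> z = ennreal ((\<alpha> + 1) / pi * (1 - (cmod z)\<^sup>2) powr \<alpha>) * indicator (ball 0 1) z"

lemma bergman_weight_measurable [measurable]: "bergman_weight \<alpha> \<in> borel_measurable borel"
proof -
  have [measurable]: "ball (0::complex) 1 \<in> sets borel" by simp
  show ?thesis unfolding bergman_weight_def[abs_def] by measurable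
qed

lemma nn_integral_area_measure:
  assumes [measurable]: "u \<in> borel_measurable borel"
  shows "(\<integral>\<^sup>+z. u z \<partial>area_measure \<alpha>) = (\<integral>\<^sup>+z. bergman_weight \<alpha> z * u z \<partial>lborel)"
proof -
  have [measurable]: "u \<in> borel_measurable (restrict_space lborel (ball 0 1))"
    "(\<lambda>z. ennreal ((\<alpha> + 1) / pi * (1 - (cmod z)\<^sup>2) powr \<alpha>)) \<in> borel_measurable (restrict_space lborel (ball 0 1))"
    by (auto intro!: measurable_restrict_space1)
  have "(\<integral>\<^sup>+z. u z \<partial>area_measure \<alpha>) =
      (\<integral>\<^sup>+z. ennreal ((\<alpha> + 1) / pi * (1 - (cmod z)\<^sup>2) powr \<alpha>) * u z \<partial>restrict_space lborel (ball 0 1))"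
    unfolding area_measure_def by (rule nn_integral_density) measurable
  also have "\<dots> = (\<integral>\<^sup>+z. bergman_weight \<alpha> z * u z \<partial>lborel)"
    by (subst nn_integral_restrict_space) (auto simp: bergman_weight_def mult_ac)
  finally show ?thesis .
qed

lemma space_area_measure [simp]: "space (area_measure \<alpha>) = ball 0 1"
  by (simp add: area_measure_def space_restrict_space)

lemma borel_measurable_area_measure:
  "u \<in> borel_measurable borel \<Longrightarrow> u \<in> borel_measurable (area_measure \<alpha>)"
  by (simp add: area_measure_def measurable_restrict_space1 cong: measurable_cong_sets)

lemma nn_integral_area_measure_rotation:
  assumes [measurable]: "u \<in> borel_measurable borel"
  shows "(\<integral>\<^sup>+z. u (cis \<theta> * z) \<partial>area_measure \<alpha>) = (\<integral>\<^sup>+z. u z \<partial>area_measure \<alpha>)"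
proof -
  have "bergman_weight \<alpha> (cis \<theta> * z) = bergman_weight \<alpha> z" for z
    by (simp add: bergman_weight_def norm_mult indicator_def)
  then have "(\<integral>\<^sup>+z. u (cis \<theta> * z) \<partial>area_measure \<alpha>) =
      (\<integral>\<^sup>+z. (\<lambda>w. bergman_weight \<alpha> w * u w) (cis \<theta> * z) \<partial>lborel)"
    by (subst nn_integral_area_measure) auto
  also have "\<dots> = (\<integral>\<^sup>+z. bergman_weight \<alpha> z * u z \<partial>lborel)"
    by (rule nn_integral_lborel_rotation) measurable
  finally show ?thesis by (simp add: nn_integral_area_measure)
qed

section \<open>Power series, norm bounds and Minkowski's inequality\<close>

definition pseries :: "(nat \<Rightarrow> complex) \<Rightarrow> complex \<Rightarrow> complex" where
  "pseries c z = (\<Sum>m. c m * z ^ m)"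

text \<open>Radius of convergence at least 1, put as a condition on a real sequence so that one
  majorant can control a whole family of coefficient sequences.\<close>

definition disc_summable :: "(nat \<Rightarrow> real) \<Rightarrow> bool" where
  "disc_summable B \<longleftrightarrow> (\<forall>r. 0 \<le> r \<and> r < 1 \<longrightarrow> summable (\<lambda>m. B m * r ^ m))"

text \<open>Stated with the nonnegative integral, because \<open>bergman_norm\<close> is 0 on functions of infinite norm.\<close>

definition pnorm_le :: "real \<Rightarrow> real \<Rightarrow> (nat \<Rightarrow> complex) \<Rightarrow> real \<Rightarrow> bool" where
  "pnorm_le p \<alpha> c r \<longleftrightarrow> (\<integral>\<^sup>+z. ennreal (cmod (pseries c z) powr p) \<partial>area_measure \<alpha>) \<le> ennreal (r powr p)"

lemma borel_measurable_pseries [measurable]: "pseries c \<in> borel_measurable borel"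
  unfolding pseries_def[abs_def] by measurable

text \<open>The convex function y^p lies above its tangent at u. The inequality is arranged without
  subtraction, so that every term survives in a nonnegative integral; it is Young's inequality for y
  and u^(p-1).\<close>

lemma powr_tangent_le:
  fixes p u y :: real
  assumes "p > 1" "u \<ge> 0" "y \<ge> 0"
  shows "p * u powr (p - 1) * y \<le> y powr p + (p - 1) * u powr p"
proof -
  define q where "q = p / (p - 1)"
  have q: "q > 1" "1 / p + 1 / q = 1" using assms by (auto simp: q_def field_simps)
  have "(p - 1) * q = p" using assms by (simp add: q_def)
  then have "y * u powr (p - 1) \<le> y powr p / p + u powr p / q"
    using Youngs_inequality[OF assms(1) q, of y "u powr (p - 1)"] assms by (simp add: powr_powr)
  then have "p * (y * u powr (p - 1)) \<le> p * (y powr p / p + u powr p / q)"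
    using assms by (intro mult_left_mono) auto
  also have "\<dots> = y powr p + (p - 1) * u powr p"
    using assms by (simp add: q_def field_simps)
  finally show ?thesis by (simp add: mult_ac)
qed

text \<open>Jensen's inequality without assuming that \<open>w y\<^sup>p\<close> is integrable.\<close>

lemma weighted_power_mean:
  fixes w y :: "'a \<Rightarrow> real"
  assumes p: "p > 1" and w: "integrable N w" "\<And>s. w s \<ge> 0"
    and y [measurable]: "y \<in> borel_measurable N" and y0: "\<And>s. y s \<ge> 0"
    and wy: "integrable N (\<lambda>s. w s * y s)"
  shows "ennreal ((LINT s|N. w s * y s) powr p) \<le>
    ennreal ((LINT s|N. w s) powr (p - 1)) * (\<integral>\<^sup>+s. ennreal (w s * y s powr p) \<partial>N)"
proof -
  have [measurable]: "w \<in> borel_measurable N" using w by auto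
  define R where "R = (LINT s|N. w s)"
  define I where "I = (LINT s|N. w s * y s)"
  define X where "X = (\<integral>\<^sup>+s. ennreal (w s * y s powr p) \<partial>N)"
  have R0: "R \<ge> 0" unfolding R_def using w by simp
  have I0: "I \<ge> 0" unfolding I_def using w y0 by (intro integral_nonneg_AE) auto
  show ?thesis
  proof (cases "R = 0")
    case True
    then have "AE s in N. w s = 0"
      using w integral_nonneg_eq_0_iff_AE[OF w(1)] by (auto simp: R_def)
    then have "I = 0" unfolding I_def by (intro integral_eq_zero_AE) auto
    then show ?thesis using p by (simp flip: I_def)
  next
    case False
    then have R: "R > 0" using R0 by simp
    \<comment> \<open>The weighted mean of y: with the tangent taken at this point, integrating the
      tangent inequality against w gives Jensen's inequality.\<close>
    define u where "u = I / R"
    have u: "u \<ge> 0" using I0 R by (simp add: u_def)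
    have "ennreal (p * u powr (p - 1) * I) = (\<integral>\<^sup>+s. ennreal (p * u powr (p - 1) * (w s * y s)) \<partial>N)"
      unfolding I_def using wy p w y0 by (subst nn_integral_eq_integral) auto
    also have "\<dots> \<le> (\<integral>\<^sup>+s. ennreal (w s * y s powr p) + ennreal ((p - 1) * u powr p * w s) \<partial>N)"
    proof (rule nn_integral_mono)
      fix s
      have "w s * (p * u powr (p - 1) * y s) \<le> w s * (y s powr p + (p - 1) * u powr p)"
        using w y0 u p by (intro mult_left_mono powr_tangent_le) auto
      moreover have "0 \<le> (p - 1) * u powr p * w s" using w p by simp
      ultimately show "ennreal (p * u powr (p - 1) * (w s * y s)) \<le>
          ennreal (w s * y s powr p) + ennreal ((p - 1) * u powr p * w s)"
        using w by (subst ennreal_plus[symmetric]) (auto intro!: ennreal_leI simp: algebra_simps)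
    qed
    also have "\<dots> = X + (\<integral>\<^sup>+s. ennreal ((p - 1) * u powr p * w s) \<partial>N)"
      unfolding X_def by (rule nn_integral_add) auto
    also have "(\<integral>\<^sup>+s. ennreal ((p - 1) * u powr p * w s) \<partial>N) = ennreal ((p - 1) * u powr p * R)"
      unfolding R_def using w p by (subst nn_integral_eq_integral) auto
    finally have le: "ennreal (p * u powr (p - 1) * I) \<le> X + ennreal ((p - 1) * u powr p * R)" .
    have uI: "u powr (p - 1) * I = u powr p * R"
    proof -
      have "I = u * R" using R by (simp add: u_def)
      then show ?thesis using u powr_mult_base[of u "p - 1"] by (simp add: mult_ac)
    qed
    have "ennreal (u powr p * R) \<le> X"
    proof (cases "X = \<infinity>")
      case False
      then obtain x where x: "X = ennreal x" "x \<ge> 0" by (cases X) auto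
      then have "p * u powr (p - 1) * I \<le> x + (p - 1) * u powr p * R"
        using le p R by (simp flip: ennreal_plus)
      then have "p * (u powr (p - 1) * I) \<le> x + (p - 1) * (u powr p * R)" by (simp add: mult.assoc)
      then have "u powr p * R \<le> x" unfolding uI by (simp add: algebra_simps)
      then show ?thesis using x by (auto intro!: ennreal_leI)
    qed simp
    then have "ennreal (R powr (p - 1)) * ennreal (u powr p * R) \<le> ennreal (R powr (p - 1)) * X"
      by (rule mult_left_mono) simp
    also have "ennreal (R powr (p - 1)) * ennreal (u powr p * R) = ennreal (I powr p)"
    proof -
      have "R powr (p - 1) * (u powr p * R) = u powr p * (R * R powr (p - 1))" by (simp add: mult_ac)
      also have "\<dots> = I powr p"
        using R I0 powr_mult_base[of R "p - 1"] by (simp add: u_def powr_divide)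
      finally show ?thesis using R by (simp flip: ennreal_mult)
    qed
    finally show ?thesis by (simp add: R_def I_def X_def)
  qed
qed

lemma disc_summableD: "disc_summable B \<Longrightarrow> 0 \<le> r \<Longrightarrow> r < 1 \<Longrightarrow> summable (\<lambda>m. B m * r ^ m)"
  by (simp add: disc_summable_def)

lemma pseries_summable:
  assumes "disc_summable B" "\<And>m. cmod (c m) \<le> B m" "cmod z < 1"
  shows "summable (\<lambda>m. c m * z ^ m)"
proof (rule summable_comparison_test')
  show "summable (\<lambda>m. B m * cmod z ^ m)"
    by (rule disc_summableD) (use assms in auto)
  show "norm (c m * z ^ m) \<le> B m * cmod z ^ m" for m
    using assms(2) by (auto simp: norm_mult norm_power intro!: mult_right_mono)
qed

text \<open>At a fixed point of the disc, sum and integral may be exchanged because the integral of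
  |k| times the sum of \<open>B m * cmod z ^ m\<close> dominates everything.\<close>

lemma pseries_integral:
  fixes k :: "'a \<Rightarrow> real"
  assumes [measurable]: "k \<in> borel_measurable N" "\<And>m. (\<lambda>s. c s m) \<in> borel_measurable N"
    and k: "integrable N k" and B: "disc_summable B" "\<And>s m. cmod (c s m) \<le> B m" and z: "cmod z < 1"
  shows "integrable N (\<lambda>s. k s *\<^sub>R pseries (c s) z)"
    and "pseries (\<lambda>m. LINT s|N. k s *\<^sub>R c s m) z = (LINT s|N. k s *\<^sub>R pseries (c s) z)"
proof -
  have bd: "norm (k s *\<^sub>R c s m * z ^ m) \<le> norm (\<bar>k s\<bar> * (B m * cmod z ^ m))" for s m
  proof -
    have "norm (k s *\<^sub>R c s m * z ^ m) \<le> \<bar>k s\<bar> * (B m * cmod z ^ m)"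
      using B(2) by (auto simp: norm_mult norm_power mult.assoc intro!: mult_left_mono mult_right_mono)
    then show ?thesis by simp
  qed
  have B0: "B m \<ge> 0" for m using norm_ge_zero B(2) order_trans by blast
  have int: "integrable N (\<lambda>s. k s *\<^sub>R c s m * z ^ m)" for m
    by (rule Bochner_Integration.integrable_bound[of _ "\<lambda>s. \<bar>k s\<bar> * (B m * cmod z ^ m)"])
       (use k bd in auto)
  have sm: "summable (\<lambda>m. c s m * z ^ m)" for s
    by (rule pseries_summable[OF B(1) B(2) z])
  have sm2: "summable (\<lambda>m. norm (k s *\<^sub>R c s m * z ^ m))" for s
  proof (rule summable_comparison_test')
    show "summable (\<lambda>m. \<bar>k s\<bar> * (B m * cmod z ^ m))"
      by (intro summable_mult disc_summableD[OF B(1)]) (use z in auto)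
    show "norm (norm (k s *\<^sub>R c s m * z ^ m)) \<le> \<bar>k s\<bar> * (B m * cmod z ^ m)" for m
      using bd[of s m] B0[of m] by simp
  qed
  have sm3: "summable (\<lambda>m. LINT s|N. norm (k s *\<^sub>R c s m * z ^ m))"
  proof (rule summable_comparison_test')
    show "summable (\<lambda>m. (LINT s|N. \<bar>k s\<bar>) * (B m * cmod z ^ m))"
      by (intro summable_mult disc_summableD[OF B(1)]) (use z in auto)
    fix m
    have "(LINT s|N. norm (k s *\<^sub>R c s m * z ^ m)) \<le> (LINT s|N. \<bar>k s\<bar> * (B m * cmod z ^ m))"
      by (rule integral_mono) (use integrable_norm[OF int] k bd B0 in auto)
    then show "norm (LINT s|N. norm (k s *\<^sub>R c s m * z ^ m)) \<le> (LINT s|N. \<bar>k s\<bar>) * (B m * cmod z ^ m)"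
      by simp
  qed
  have eq: "(\<Sum>m. k s *\<^sub>R c s m * z ^ m) = k s *\<^sub>R pseries (c s) z" for s
    unfolding pseries_def by (subst suminf_scaleR_right[OF sm]) simp
  show "integrable N (\<lambda>s. k s *\<^sub>R pseries (c s) z)"
    using integrable_suminf[OF int AE_I2[OF sm2] sm3] by (simp only: eq)
  have "(LINT s|N. k s *\<^sub>R pseries (c s) z) = (\<Sum>m. LINT s|N. k s *\<^sub>R c s m * z ^ m)"
    using integral_suminf[OF int AE_I2[OF sm2] sm3] by (simp only: eq)
  also have "\<dots> = pseries (\<lambda>m. LINT s|N. k s *\<^sub>R c s m) z"
    unfolding pseries_def by (simp only: integral_mult_left_zero)
  finally show "pseries (\<lambda>m. LINT s|N. k s *\<^sub>R c s m) z = (LINT s|N. k s *\<^sub>R pseries (c s) z)" ..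
qed

text \<open>Minkowski's integral inequality; over a counting measure it is the triangle inequality.\<close>

lemma pnorm_le_integral:
  fixes k r :: "'a \<Rightarrow> real"
  assumes p: "p > 1" and "sigma_finite_measure N"
    and meas [measurable]: "k \<in> borel_measurable N" "r \<in> borel_measurable N" "\<And>m. (\<lambda>s. c s m) \<in> borel_measurable N"
    and r: "\<And>s. r s > 0"
    and k: "integrable N k" "integrable N (\<lambda>s. \<bar>k s\<bar> * r s)"
    and B: "disc_summable B" "\<And>s m. cmod (c s m) \<le> B m"
    and c: "\<And>s. k s \<noteq> 0 \<Longrightarrow> pnorm_le p \<alpha> (c s) (r s)"
  shows "pnorm_le p \<alpha> (\<lambda>m. LINT s|N. k s *\<^sub>R c s m) (LINT s|N. \<bar>k s\<bar> * r s)"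
proof -
  interpret N: sigma_finite_measure N by fact
  interpret P: pair_sigma_finite N "lborel :: complex measure" ..
  \<comment> \<open>Dividing each series by its own radius and putting the radius into the weight
    makes all normalised p-th moments at most 1. Jensen with total mass R followed by Tonelli then
    gives R^(p-1) R = R^p.\<close>
  define w where "w = (\<lambda>s. \<bar>k s\<bar> * r s)"
  define R where "R = (LINT s|N. w s)"
  define y where "y = (\<lambda>z s. cmod (pseries (c s) z) / r s)"
  have [measurable]: "w \<in> borel_measurable N" unfolding w_def by measurable
  have w0: "w s \<ge> 0" for s unfolding w_def using r[of s] by simp
  have wI: "integrable N w" unfolding w_def using k by simp
  have R0: "R \<ge> 0" unfolding R_def using w0 by simp
  have y0: "y z s \<ge> 0" for z s using r[of s] by (simp add: y_def)
  have mP [measurable]: "(\<lambda>(s, z). pseries (c s) z) \<in> borel_measurable (N \<Otimes>\<^sub>M lborel)"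
    unfolding pseries_def by measurable
  have [measurable]: "(\<lambda>s. pseries (c s) z) \<in> borel_measurable N" for z
    unfolding pseries_def by measurable
  have my [measurable]: "(\<lambda>(s, z). y z s) \<in> borel_measurable (N \<Otimes>\<^sub>M lborel)"
    unfolding y_def by measurable
  have [measurable]: "y z \<in> borel_measurable N" for z
    unfolding y_def by measurable
  have point: "ennreal (cmod (pseries (\<lambda>m. LINT s|N. k s *\<^sub>R c s m) z) powr p) \<le>
      ennreal (R powr (p - 1)) * (\<integral>\<^sup>+s. ennreal (w s * y z s powr p) \<partial>N)" if z: "cmod z < 1" for z
  proof -
    note PI = pseries_integral[OF meas(1) meas(3) k(1) B z]
    have wy: "w s * y z s = norm (k s *\<^sub>R pseries (c s) z)" for s
      using r[of s] by (simp add: w_def y_def)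
    have "cmod (pseries (\<lambda>m. LINT s|N. k s *\<^sub>R c s m) z) \<le> (LINT s|N. w s * y z s)"
      unfolding PI(2) wy by (rule integral_norm_bound)
    then have "cmod (pseries (\<lambda>m. LINT s|N. k s *\<^sub>R c s m) z) powr p \<le> (LINT s|N. w s * y z s) powr p"
      using p by (intro powr_mono2) auto
    then have "ennreal (cmod (pseries (\<lambda>m. LINT s|N. k s *\<^sub>R c s m) z) powr p) \<le> ennreal ((LINT s|N. w s * y z s) powr p)"
      by (rule ennreal_leI)
    also have "\<dots> \<le> ennreal (R powr (p - 1)) * (\<integral>\<^sup>+s. ennreal (w s * y z s powr p) \<partial>N)"
      unfolding R_def
      by (rule weighted_power_mean[OF p wI w0 _ y0]) (use integrable_norm[OF PI(1)] in \<open>simp_all add: wy\<close>)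
    finally show ?thesis .
  qed
  have [measurable]: "(\<lambda>z. \<integral>\<^sup>+s. ennreal (w s * y z s powr p) \<partial>N) \<in> borel_measurable lborel"
    by measurable
  have inner: "(\<integral>\<^sup>+z. bergman_weight \<alpha> z * ennreal (w s * y z s powr p) \<partial>lborel) \<le> ennreal (w s)" for s
  proof (cases "k s = 0")
    case True
    then show ?thesis by (simp add: w_def)
  next
    case False
    have "(\<integral>\<^sup>+z. bergman_weight \<alpha> z * ennreal (w s * y z s powr p) \<partial>lborel) =
        (\<integral>\<^sup>+z. ennreal (w s * r s powr (- p)) * (bergman_weight \<alpha> z * ennreal (cmod (pseries (c s) z) powr p)) \<partial>lborel)"
      using r[of s] w0[of s]
      by (intro nn_integral_cong)
         (simp add: y_def powr_divide powr_minus ennreal_mult[symmetric] divide_simps mult_ac flip: mult.assoc)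
    also have "\<dots> = ennreal (w s * r s powr (- p)) * (\<integral>\<^sup>+z. ennreal (cmod (pseries (c s) z) powr p) \<partial>area_measure \<alpha>)"
      by (simp add: nn_integral_cmult nn_integral_area_measure)
    also have "\<dots> \<le> ennreal (w s * r s powr (- p)) * ennreal (r s powr p)"
      using c[OF False] by (intro mult_left_mono) (auto simp: pnorm_le_def)
    also have "\<dots> = ennreal (w s)"
      using r[of s] w0[of s] by (simp add: ennreal_mult[symmetric] powr_minus)
    finally show ?thesis .
  qed
  have "(\<integral>\<^sup>+z. ennreal (cmod (pseries (\<lambda>m. LINT s|N. k s *\<^sub>R c s m) z) powr p) \<partial>area_measure \<alpha>) \<le>
      (\<integral>\<^sup>+z. ennreal (R powr (p - 1)) * (\<integral>\<^sup>+s. ennreal (w s * y z s powr p) \<partial>N) \<partial>area_measure \<alpha>)"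
    by (rule nn_integral_mono) (simp add: point)
  also have "\<dots> = (\<integral>\<^sup>+z. ennreal (R powr (p - 1)) * (bergman_weight \<alpha> z * (\<integral>\<^sup>+s. ennreal (w s * y z s powr p) \<partial>N)) \<partial>lborel)"
    by (subst nn_integral_area_measure) (auto simp: mult_ac)
  also have "\<dots> = ennreal (R powr (p - 1)) * (\<integral>\<^sup>+z. bergman_weight \<alpha> z * (\<integral>\<^sup>+s. ennreal (w s * y z s powr p) \<partial>N) \<partial>lborel)"
    by (rule nn_integral_cmult) measurable
  also have "(\<integral>\<^sup>+z. bergman_weight \<alpha> z * (\<integral>\<^sup>+s. ennreal (w s * y z s powr p) \<partial>N) \<partial>lborel) =
      (\<integral>\<^sup>+z. \<integral>\<^sup>+s. bergman_weight \<alpha> z * ennreal (w s * y z s powr p) \<partial>N \<partial>lborel)"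
    by (intro nn_integral_cong nn_integral_cmult[symmetric]) measurable
  also have "\<dots> = (\<integral>\<^sup>+s. \<integral>\<^sup>+z. bergman_weight \<alpha> z * ennreal (w s * y z s powr p) \<partial>lborel \<partial>N)"
    by (rule P.Fubini') measurable
  also have "\<dots> \<le> (\<integral>\<^sup>+s. ennreal (w s) \<partial>N)"
    by (intro nn_integral_mono inner)
  also have "\<dots> = ennreal R"
    unfolding R_def using wI w0 by (subst nn_integral_eq_integral) auto
  also have "ennreal (R powr (p - 1)) * ennreal R = ennreal (R powr p)"
    using R0 powr_mult_base[OF R0, of "p - 1"] by (simp add: mult.commute flip: ennreal_mult)
  finally show ?thesis
    unfolding pnorm_le_def R_def w_def by (simp add: mult_left_mono)
qed

lemma pnorm_le_mono:
  assumes "pnorm_le p \<alpha> c r" "0 \<le> r" "r \<le> r'" "p > 1"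
  shows "pnorm_le p \<alpha> c r'"
  using assms unfolding pnorm_le_def
  by (meson ennreal_leI less_le_trans order_trans powr_mono2 less_imp_le zero_less_one)

lemma pnorm_le_cmult:
  assumes "pnorm_le p \<alpha> c r" "disc_summable (\<lambda>m. cmod (c m))" "r \<ge> 0"
  shows "pnorm_le p \<alpha> (\<lambda>m. a * c m) (cmod a * r)"
proof -
  have "pseries (\<lambda>m. a * c m) z = a * pseries c z" if "cmod z < 1" for z
    unfolding pseries_def using pseries_summable[OF assms(2) order_refl that]
    by (subst suminf_mult[symmetric]) (simp_all add: mult.assoc)
  then have "(\<integral>\<^sup>+z. ennreal (cmod (pseries (\<lambda>m. a * c m) z) powr p) \<partial>area_measure \<alpha>) =
      (\<integral>\<^sup>+z. ennreal (cmod a powr p) * ennreal (cmod (pseries c z) powr p) \<partial>area_measure \<alpha>)"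
    by (intro nn_integral_cong) (simp add: norm_mult powr_mult ennreal_mult)
  also have "\<dots> = ennreal (cmod a powr p) * (\<integral>\<^sup>+z. ennreal (cmod (pseries c z) powr p) \<partial>area_measure \<alpha>)"
    by (rule nn_integral_cmult) (rule borel_measurable_area_measure, measurable)
  also have "\<dots> \<le> ennreal (cmod a powr p) * ennreal (r powr p)"
    using assms(1) by (intro mult_left_mono) (auto simp: pnorm_le_def)
  also have "\<dots> = ennreal ((cmod a * r) powr p)"
    using assms(3) by (simp add: powr_mult ennreal_mult)
  finally show ?thesis unfolding pnorm_le_def .
qed

lemma pnorm_le_rotation:
  assumes "pnorm_le p \<alpha> c r"
  shows "pnorm_le p \<alpha> (\<lambda>m. c m * cis (real m * \<theta>)) r"
proof -
  have "pseries (\<lambda>m. c m * cis (real m * \<theta>)) z = pseries c (cis \<theta> * z)" for z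
    unfolding pseries_def by (simp add: power_mult_distrib Complex.DeMoivre mult.assoc)
  moreover have "(\<integral>\<^sup>+z. ennreal (cmod (pseries c (cis \<theta> * z)) powr p) \<partial>area_measure \<alpha>) =
      (\<integral>\<^sup>+z. ennreal (cmod (pseries c z) powr p) \<partial>area_measure \<alpha>)"
    by (rule nn_integral_area_measure_rotation) measurable
  ultimately show ?thesis using assms by (simp add: pnorm_le_def)
qed

lemma disc_summable_add: "disc_summable A \<Longrightarrow> disc_summable B \<Longrightarrow> disc_summable (\<lambda>m. A m + B m)"
  by (auto simp: disc_summable_def distrib_right intro: summable_add)

lemma disc_summable_cmult: "disc_summable A \<Longrightarrow> disc_summable (\<lambda>m. a * A m)"
  by (auto simp: disc_summable_def mult.assoc intro: summable_mult)

lemma disc_summable_le: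
  assumes "disc_summable B" "\<And>m. 0 \<le> A m" "\<And>m. A m \<le> B m"
  shows "disc_summable A"
  unfolding disc_summable_def
proof (intro allI impI)
  fix r :: real assume r: "0 \<le> r \<and> r < 1"
  show "summable (\<lambda>m. A m * r ^ m)"
    by (rule summable_comparison_test'[OF disc_summableD[OF assms(1)], of r 0])
       (use r assms in \<open>auto simp: abs_mult intro!: mult_right_mono\<close>)
qed

lemma pnorm_le_lincomb:
  assumes p: "p > 1" and c: "pnorm_le p \<alpha> c r" "pnorm_le p \<alpha> d s" "r > 0" "s > 0"
    and sm: "disc_summable (\<lambda>m. cmod (c m))" "disc_summable (\<lambda>m. cmod (d m))"
  shows "pnorm_le p \<alpha> (\<lambda>m. of_real a * c m + of_real b * d m) (\<bar>a\<bar> * r + \<bar>b\<bar> * s)"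
proof -
  let ?N = "count_space (UNIV :: bool set)"
  have "pnorm_le p \<alpha> (\<lambda>m. LINT i|?N. (if i then a else b) *\<^sub>R (if i then c m else d m))
      (LINT i|?N. \<bar>if i then a else b\<bar> * (if i then r else s))"
  proof (rule pnorm_le_integral[OF p, where c = "\<lambda>i m. if i then c m else d m"])
    show "sigma_finite_measure ?N" by (rule sigma_finite_measure_count_space_finite) simp
    show "disc_summable (\<lambda>m. cmod (c m) + cmod (d m))" by (rule disc_summable_add[OF sm])
  qed (use c in \<open>auto simp: integrable_count_space\<close>)
  then show ?thesis
    by (simp add: lebesgue_integral_count_space_finite UNIV_bool scaleR_conv_of_real add.commute)
qed

lemma pnorm_le_add:
  assumes "p > 1" "pnorm_le p \<alpha> c r" "pnorm_le p \<alpha> d s" "r > 0" "s > 0"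
    and "disc_summable (\<lambda>m. cmod (c m))" "disc_summable (\<lambda>m. cmod (d m))"
  shows "pnorm_le p \<alpha> (\<lambda>m. c m + d m) (r + s)"
  using pnorm_le_lincomb[OF assms, of 1 1] by simp

text \<open>Both multipliers are half a sum or difference of two rotations, up to a unimodular
  factor, so the radius does not grow.\<close>

lemma pnorm_le_cos_sin:
  assumes p: "p > 1" and c: "pnorm_le p \<alpha> c r" "r > 0" and sm: "disc_summable (\<lambda>m. cmod (c m))"
  shows "pnorm_le p \<alpha> (\<lambda>m. c m * of_real (cos (real m * \<theta>))) r"
    and "pnorm_le p \<alpha> (\<lambda>m. c m * of_real (sin (real m * \<theta>))) r"
proof -
  have sm': "disc_summable (\<lambda>m. cmod (c m * cis (real m * t)))" for t
    using sm by (simp add: norm_mult)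
  have "pnorm_le p \<alpha> (\<lambda>m. of_real (1/2) * (c m * cis (real m * \<theta>)) + of_real (1/2) * (c m * cis (real m * (- \<theta>))))
      (\<bar>1/2\<bar> * r + \<bar>1/2\<bar> * r)"
    by (intro pnorm_le_lincomb p pnorm_le_rotation c sm')
  also have "(\<lambda>m. of_real (1/2) * (c m * cis (real m * \<theta>)) + of_real (1/2) * (c m * cis (real m * (- \<theta>))))
      = (\<lambda>m. c m * of_real (cos (real m * \<theta>)))"
    by (auto simp: fun_eq_iff complex_eq_iff field_simps)
  finally show "pnorm_le p \<alpha> (\<lambda>m. c m * of_real (cos (real m * \<theta>))) r" by simp
  have "pnorm_le p \<alpha> (\<lambda>m. - \<i> * (of_real (1/2) * (c m * cis (real m * \<theta>)) + of_real (-1/2) * (c m * cis (real m * (- \<theta>)))))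
      (cmod (- \<i>) * (\<bar>1/2\<bar> * r + \<bar>-1/2\<bar> * r))"
  proof (intro pnorm_le_cmult pnorm_le_lincomb p pnorm_le_rotation c sm')
    show "disc_summable (\<lambda>m. cmod (of_real (1/2) * (c m * cis (real m * \<theta>)) + of_real (-1/2) * (c m * cis (real m * (- \<theta>)))))"
      by (rule disc_summable_le[OF sm])
         (auto simp: norm_mult norm_divide intro!: order_trans[OF norm_triangle_ineq4])
  qed (use c in auto)
  also have "(\<lambda>m. - \<i> * (of_real (1/2) * (c m * cis (real m * \<theta>)) + of_real (-1/2) * (c m * cis (real m * (- \<theta>)))))
      = (\<lambda>m. c m * of_real (sin (real m * \<theta>)))"
    by (auto simp: fun_eq_iff complex_eq_iff field_simps)
  finally show "pnorm_le p \<alpha> (\<lambda>m. c m * of_real (sin (real m * \<theta>))) r" by simp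
qed

section \<open>The second-order Steklov mean\<close>

text \<open>This is (sin(y/2)/(y/2))^2; at y = m\<delta> it is the multiplier of averaging twice
  over an interval of length \<delta>.\<close>

definition fejer :: "real \<Rightarrow> real" where
  "fejer y = (if y = 0 then 1 else (2 - 2 * cos y) / y\<^sup>2)"

text \<open>The averaging kernel is the triangle (\<delta> - |v|)/\<delta>^2 of mass 1. Folding it
  onto [0,\<delta>] expresses the error of the mean through second differences, with the negative
  kernel (v - \<delta>)/\<delta>^2. The second integral is the origin of the 6 in
  M\<delta>/6.\<close>

lemma integral_triangle_kernel:
  assumes "\<delta> > 0"
  shows "(LBINT v:{0..\<delta>}. (v - \<delta>) / \<delta>\<^sup>2 * (2 * cos (y * v) - 2)) = 1 - fejer (y * \<delta>)"
    and "(LBINT v:{0..\<delta>}. (\<delta> - v) / \<delta>\<^sup>2 * v) = \<delta> / 6"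
proof -
  show "(LBINT v:{0..\<delta>}. (\<delta> - v) / \<delta>\<^sup>2 * v) = \<delta> / 6"
  proof -
    have "(LBINT v. ((\<delta> - v) / \<delta>\<^sup>2 * v) * indicator {0..\<delta>} v) =
        (\<lambda>v. (\<delta> * v\<^sup>2 / 2 - v ^ 3 / 3) / \<delta>\<^sup>2) \<delta> - (\<lambda>v. (\<delta> * v\<^sup>2 / 2 - v ^ 3 / 3) / \<delta>\<^sup>2) 0"
      using assms by (intro integral_FTC_Icc_real)
        (auto intro!: derivative_eq_intros continuous_intros simp: field_simps power2_eq_square)
    also have "\<dots> = \<delta> / 6" using assms by (simp add: field_simps power2_eq_square power3_eq_cube)
    finally show ?thesis by (simp add: set_lebesgue_integral_def mult.commute)
  qed
  show "(LBINT v:{0..\<delta>}. (v - \<delta>) / \<delta>\<^sup>2 * (2 * cos (y * v) - 2)) = 1 - fejer (y * \<delta>)"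
  proof (cases "y = 0")
    case False
    let ?F = "\<lambda>v. (2 * \<delta> * v - v\<^sup>2 - 2 * (\<delta> - v) * sin (y * v) / y + 2 * cos (y * v) / y\<^sup>2) / \<delta>\<^sup>2"
    have "(LBINT v. ((v - \<delta>) / \<delta>\<^sup>2 * (2 * cos (y * v) - 2)) * indicator {0..\<delta>} v) = ?F \<delta> - ?F 0"
      using assms False by (intro integral_FTC_Icc_real)
        (auto intro!: derivative_eq_intros continuous_intros simp: field_simps power2_eq_square)
    also have "\<dots> = 1 - fejer (y * \<delta>)"
      using assms False by (simp add: fejer_def field_simps power2_eq_square)
    finally show ?thesis by (simp add: set_lebesgue_integral_def mult.commute)
  qed (simp add: fejer_def)
qed

lemma pnorm_le_steklov:
  assumes p: "p > 1" and M: "M > 0" and \<delta>: "\<delta> > 0" and sm: "disc_summable (\<lambda>m. cmod (b m))"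
    and b: "\<And>v. v > 0 \<Longrightarrow> pnorm_le p \<alpha> (\<lambda>m. b m * of_real (2 * cos (real m * v) - 2)) (M * v)"
  shows "pnorm_le p \<alpha> (\<lambda>m. b m * of_real (1 - fejer (real m * \<delta>))) (M * \<delta> / 6)"
proof -
  define k where "k = (\<lambda>v. indicator {0..\<delta>} v * ((v - \<delta>) / \<delta>\<^sup>2))"
  \<comment> \<open>Minkowski's inequality asks for positive radii at every v. The value M for v
    \<le> 0 is harmless: the kernel vanishes for v < 0, and at v = 0, a null set, all coefficients
    are 0.\<close>
  define r where "r = (\<lambda>v. if v > 0 then M * v else M)"
  have kI: "integrable lborel (\<lambda>v. k v * g v)" if "continuous_on {0..\<delta>} g" for g :: "real \<Rightarrow> real"
  proof -
    have "set_integrable lborel {0..\<delta>} (\<lambda>v. (v - \<delta>) / \<delta>\<^sup>2 * g v)"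
      by (intro borel_integrable_atLeastAtMost' continuous_intros that) (use \<delta> in auto)
    then show ?thesis by (simp add: set_integrable_def k_def mult.assoc)
  qed
  have kr: "\<bar>k v\<bar> * r v = indicator {0..\<delta>} v *\<^sub>R ((\<delta> - v) / \<delta>\<^sup>2 * r v)" for v
  proof -
    have "\<bar>(v - \<delta>) / \<delta>\<^sup>2\<bar> = (\<delta> - v) / \<delta>\<^sup>2" if "v \<le> \<delta>"
      using that by (simp add: abs_divide)
    then show ?thesis by (auto simp only: k_def indicator_def abs_mult) auto
  qed
  have krM: "indicator {0..\<delta>} v *\<^sub>R ((\<delta> - v) / \<delta>\<^sup>2 * r v) = - M * (k v * v)" if "v \<noteq> 0" for v
    using that by (auto simp: r_def k_def indicator_def field_simps)
  have [measurable]: "k \<in> borel_measurable borel" "r \<in> borel_measurable borel"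
    unfolding k_def r_def by measurable
  have ae: "AE v in lborel. \<bar>k v\<bar> * r v = - M * (k v * v)"
    using AE_lborel_singleton[of 0] by eventually_elim (subst kr, rule krM)
  have "pnorm_le p \<alpha> (\<lambda>m. LINT v|lborel. k v *\<^sub>R (b m * of_real (2 * cos (real m * v) - 2)))
      (LINT v|lborel. \<bar>k v\<bar> * r v)"
  proof (rule pnorm_le_integral[OF p, where c = "\<lambda>v m. b m * of_real (2 * cos (real m * v) - 2)"])
    show "r v > 0" for v using M by (simp add: r_def)
    show "integrable lborel k" using kI[of "\<lambda>_. 1"] by simp
    have "integrable lborel (\<lambda>v. - M * (k v * v))" using kI[of "\<lambda>v. v"] by (intro integrable_mult_right) auto
    then show "integrable lborel (\<lambda>v. \<bar>k v\<bar> * r v)"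
      by (subst integrable_cong_AE[OF _ _ ae]) auto
    show "disc_summable (\<lambda>m. 4 * cmod (b m))" by (rule disc_summable_cmult[OF sm])
    show "cmod (b m * of_real (2 * cos (real m * v) - 2)) \<le> 4 * cmod (b m)" for v m
    proof -
      have "\<bar>2 * cos (real m * v) - 2\<bar> \<le> 4"
        using cos_le_one[of "real m * v"] cos_ge_minus_one[of "real m * v"] by linarith
      then have "cmod (b m) * \<bar>2 * cos (real m * v) - 2\<bar> \<le> cmod (b m) * 4"
        by (rule mult_left_mono) simp
      then show ?thesis by (simp add: norm_mult mult.commute del: of_real_diff of_real_mult)
    qed
    show "pnorm_le p \<alpha> (\<lambda>m. b m * of_real (2 * cos (real m * v) - 2)) (r v)" if "k v \<noteq> 0" for v
    proof (cases "v = 0")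
      case True
      then show ?thesis using p by (simp add: pnorm_le_def pseries_def)
    next
      case False
      then show ?thesis using that b[of v] by (auto simp: r_def k_def indicator_def split: if_splits)
    qed
  qed (auto intro: lborel.sigma_finite_measure_axioms)
  also have "(LINT v|lborel. \<bar>k v\<bar> * r v) = (LINT v|lborel. - M * (k v * v))"
    by (rule integral_cong_AE) (use ae in auto)
  also have "\<dots> = M * (LBINT v:{0..\<delta>}. (\<delta> - v) / \<delta>\<^sup>2 * v)"
    unfolding set_lebesgue_integral_def
    by (subst integral_mult_right_zero[symmetric]) (auto intro!: Bochner_Integration.integral_cong simp: k_def indicator_def field_simps)
  also have "\<dots> = M * \<delta> / 6" by (simp only: integral_triangle_kernel(2)[OF \<delta>])
  also have "(\<lambda>m. LINT v|lborel. k v *\<^sub>R (b m * of_real (2 * cos (real m * v) - 2))) =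
      (\<lambda>m. b m * of_real (1 - fejer (real m * \<delta>)))"
  proof
    fix m
    have "(LINT v|lborel. k v *\<^sub>R (b m * of_real (2 * cos (real m * v) - 2))) =
        (LINT v|lborel. b m * of_real (k v * (2 * cos (real m * v) - 2)))"
      by (simp add: scaleR_conv_of_real mult_ac)
    also have "\<dots> = b m * of_real (LINT v|lborel. k v * (2 * cos (real m * v) - 2))"
      by (simp only: integral_mult_right_zero integral_complex_of_real)
    also have "(LINT v|lborel. k v * (2 * cos (real m * v) - 2)) = 1 - fejer (real m * \<delta>)"
      unfolding integral_triangle_kernel(1)[OF \<delta>, symmetric] set_lebesgue_integral_def
      by (simp add: k_def mult.assoc)
    finally show "(LINT v|lborel. k v *\<^sub>R (b m * of_real (2 * cos (real m * v) - 2))) =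
        b m * of_real (1 - fejer (real m * \<delta>))" .
  qed
  finally show ?thesis .
qed

section \<open>Passage to the Bergman norm\<close>

lemma bergman_norm_eq:
  assumes "\<And>z. cmod z < 1 \<Longrightarrow> f z = pseries c z"
  shows "bergman_norm p \<alpha> f = (LINT z|area_measure \<alpha>. cmod (pseries c z) powr p) powr (1 / p)"
  unfolding bergman_norm_def
  by (rule arg_cong[where f = "\<lambda>x. x powr (1 / p)"], rule Bochner_Integration.integral_cong) (use assms in auto)

lemma bergman_norm_le:
  assumes p: "p > 1" and c: "pnorm_le p \<alpha> c r" "r \<ge> 0"
    and f: "\<And>z. cmod z < 1 \<Longrightarrow> f z = pseries c z"
  shows "bergman_norm p \<alpha> f \<le> r"
proof -
  have eq: "bergman_norm p \<alpha> f = (LINT z|area_measure \<alpha>. cmod (pseries c z) powr p) powr (1 / p)"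
    by (rule bergman_norm_eq) (rule f)
  have "(LINT z|area_measure \<alpha>. cmod (pseries c z) powr p) =
      enn2real (\<integral>\<^sup>+z. ennreal (cmod (pseries c z) powr p) \<partial>area_measure \<alpha>)"
    by (rule integral_eq_nn_integral) (auto intro!: borel_measurable_area_measure)
  also have "\<dots> \<le> enn2real (ennreal (r powr p))"
    using c unfolding pnorm_le_def by (intro enn2real_mono) auto
  finally have "(LINT z|area_measure \<alpha>. cmod (pseries c z) powr p) \<le> r powr p" by simp
  then have "bergman_norm p \<alpha> f \<le> (r powr p) powr (1 / p)"
    unfolding eq using p by (intro powr_mono2) auto
  also have "\<dots> = r" using p c(2) by (simp add: powr_powr)
  finally show ?thesis .
qed

text \<open>The radius r only certifies that the integral is finite; then
  \<open>bergman_norm\<close> is the true norm and the sharper bound s can be read off it.\<close>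

lemma pnorm_le_bergman_norm:
  assumes p: "p > 1" and c: "pnorm_le p \<alpha> c r"
    and f: "\<And>z. cmod z < 1 \<Longrightarrow> f z = pseries c z" and "bergman_norm p \<alpha> f \<le> s"
  shows "pnorm_le p \<alpha> c s"
proof -
  have eq: "bergman_norm p \<alpha> f = (LINT z|area_measure \<alpha>. cmod (pseries c z) powr p) powr (1 / p)"
    by (rule bergman_norm_eq) (rule f)
  have "integrable (area_measure \<alpha>) (\<lambda>z. cmod (pseries c z) powr p)"
    by (rule integrableI_bounded)
       (use c in \<open>auto simp: pnorm_le_def intro!: borel_measurable_area_measure elim: le_less_trans\<close>)
  then have "(\<integral>\<^sup>+z. ennreal (cmod (pseries c z) powr p) \<partial>area_measure \<alpha>) =
      ennreal (LINT z|area_measure \<alpha>. cmod (pseries c z) powr p)"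
    by (intro nn_integral_eq_integral) auto
  also have "(LINT z|area_measure \<alpha>. cmod (pseries c z) powr p) = bergman_norm p \<alpha> f powr p"
    unfolding eq using p by (simp add: powr_powr)
  also have "\<dots> \<le> s powr p"
    using assms(4) p by (intro powr_mono2) (auto simp: bergman_norm_def)
  finally show ?thesis unfolding pnorm_le_def by (simp add: ennreal_leI)
qed

section \<open>Approximation\<close>

text \<open>An average of rotations by angles t/\<sigma> with density (4/pi) \<open>H_fun k\<close>,
  whose total variation is \<open>C_const k\<close>. The scaling by \<sigma> changes the
  multiplier's argument but not this constant.\<close>

lemma pnorm_le_H_transform:
  assumes p: "p > 1" and c: "pnorm_le p \<alpha> c r" "r > 0" and sm: "disc_summable (\<lambda>m. cmod (c m))"
  shows "pnorm_le p \<alpha> (\<lambda>m. c m * of_real (4 / pi * H_transform k (real m / \<sigma>))) (C_const k * r)"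
proof -
  define \<kappa> where "\<kappa> = (\<lambda>t. indicator {0<..} t *\<^sub>R (4 / pi * H_fun k t))"
  have \<kappa>I: "integrable lborel \<kappa>"
    unfolding \<kappa>_def set_integrable_def[symmetric] by (intro set_integrable_mult_right set_integrable_H_fun)
  have "pnorm_le p \<alpha> (\<lambda>m. LINT t|lborel. \<kappa> t *\<^sub>R (c m * of_real (trig k (real m * (t / \<sigma>))))) (LINT t|lborel. \<bar>\<kappa> t\<bar> * r)"
  proof (rule pnorm_le_integral[OF p, where c = "\<lambda>t m. c m * of_real (trig k (real m * (t / \<sigma>)))"])
    show "integrable lborel (\<lambda>t. \<bar>\<kappa> t\<bar> * r)"
      by (rule integrable_mult_left) (use \<kappa>I in auto)
    show "pnorm_le p \<alpha> (\<lambda>m. c m * of_real (trig k (real m * (t / \<sigma>)))) r" for t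
      unfolding trig_def using pnorm_le_cos_sin[OF p c sm, of "t / \<sigma>"] by (cases "even k") simp_all
    show "cmod (c m * of_real (trig k (real m * (t / \<sigma>)))) \<le> cmod (c m)" for t m
      by (simp add: norm_mult mult_left_le)
    have [measurable]: "trig k \<in> borel_measurable borel" by simp
    show "(\<lambda>t. c m * of_real (trig k (real m * (t / \<sigma>)))) \<in> borel_measurable lborel" for m
      by measurable
  qed (use \<kappa>I sm c in \<open>auto intro: lborel.sigma_finite_measure_axioms\<close>)
  also have "(LINT t|lborel. \<bar>\<kappa> t\<bar> * r) = C_const k * r"
  proof -
    have "\<bar>\<kappa> t\<bar> = 4 / pi * (indicator {0<..} t *\<^sub>R \<bar>H_fun k t\<bar>)" for t
      by (auto simp: \<kappa>_def indicator_def abs_mult)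
    then show ?thesis by (simp add: C_const_eq set_lebesgue_integral_def)
  qed
  also have "(\<lambda>m. LINT t|lborel. \<kappa> t *\<^sub>R (c m * of_real (trig k (real m * (t / \<sigma>))))) =
      (\<lambda>m. c m * of_real (4 / pi * H_transform k (real m / \<sigma>)))"
  proof
    fix m
    have "(LINT t|lborel. \<kappa> t *\<^sub>R (c m * of_real (trig k (real m * (t / \<sigma>))))) =
        (LINT t|lborel. c m * of_real (4 / pi * (indicator {0<..} t *\<^sub>R (trig k (real m / \<sigma> * t) * H_fun k t))))"
      by (intro Bochner_Integration.integral_cong) (auto simp: \<kappa>_def indicator_def scaleR_conv_of_real)
    also have "\<dots> = c m * of_real (4 / pi * H_transform k (real m / \<sigma>))"
      unfolding H_transform_def set_lebesgue_integral_def
      by (simp only: integral_mult_right_zero integral_complex_of_real)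
    finally show "(LINT t|lborel. \<kappa> t *\<^sub>R (c m * of_real (trig k (real m * (t / \<sigma>))))) =
        c m * of_real (4 / pi * H_transform k (real m / \<sigma>))" .
  qed
  finally show ?thesis .
qed

section \<open>Taylor coefficients of angular derivatives and second differences\<close>

lemma disc_summable_norm:
  assumes "\<And>z. cmod z < 1 \<Longrightarrow> summable (\<lambda>m. c m * z ^ m)"
  shows "disc_summable (\<lambda>m. cmod (c m))"
  unfolding disc_summable_def
proof (intro allI impI)
  fix r :: real assume r: "0 \<le> r \<and> r < 1"
  then obtain s where s: "r < s" "s < 1" using dense by blast
  have "summable (\<lambda>m. norm (c m * of_real r ^ m))"
    by (rule powser_insidea[of c "of_real s"]) (use assms[of "of_real s"] r s in auto)
  then show "summable (\<lambda>m. cmod (c m) * r ^ m)"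
    using r by (simp add: norm_mult norm_power)
qed

lemma pseries_angular_derivative:
  assumes sm: "disc_summable (\<lambda>m. cmod (c m))"
  shows "disc_summable (\<lambda>m. cmod (\<i> * of_nat m * c m))"
    and "0 \<le> r \<Longrightarrow> r < 1 \<Longrightarrow> ((\<lambda>\<theta>. pseries c (rcis r \<theta>)) has_vector_derivative
      pseries (\<lambda>m. \<i> * of_nat m * c m) (rcis r \<theta>)) (at \<theta>)"
proof -
  have s: "summable (\<lambda>m. c m * z ^ m)" if "cmod z < 1" for z
    by (rule pseries_summable[OF sm order_refl that])
  have sd: "summable (\<lambda>m. diffs c m * z ^ m)" if "cmod z < 1" for z
    by (rule termdiff_converges[OF that s])
  have eq: "(\<lambda>m. \<i> * of_nat m * c m * z ^ m) sums (\<i> * z * (\<Sum>m. diffs c m * z ^ m))" if "cmod z < 1" for z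
  proof -
    have "(\<lambda>m. \<i> * z * (of_nat m * c m * z ^ (m - Suc 0))) sums (\<i> * z * (\<Sum>m. diffs c m * z ^ m))"
      by (intro sums_mult diffs_equiv sd that)
    moreover have "\<i> * z * (of_nat m * c m * z ^ (m - Suc 0)) = \<i> * of_nat m * c m * z ^ m" for m
      by (cases m) simp_all
    ultimately show ?thesis by simp
  qed
  show "disc_summable (\<lambda>m. cmod (\<i> * of_nat m * c m))"
    by (rule disc_summable_norm) (use eq sums_summable in blast)
  assume r: "0 \<le> r" "r < 1"
  define z where "z = rcis r \<theta>"
  have z: "cmod z < 1" using r by (simp add: z_def)
  have "DERIV (pseries c) z :> (\<Sum>m. diffs c m * z ^ m)"
    unfolding pseries_def[abs_def]
  proof (rule termdiffs_strong)
    show "summable (\<lambda>m. c m * of_real ((1 + cmod z) / 2) ^ m)"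
      using z by (intro s) (simp add: norm_divide del: of_real_add of_real_divide)
    have "norm (complex_of_real ((1 + cmod z) / 2)) = (1 + cmod z) / 2"
      by (simp only: norm_of_real) simp
    then show "norm z < norm (complex_of_real ((1 + cmod z) / 2))" using z by simp
  qed
  moreover have "(rcis r has_vector_derivative \<i> * z) (at \<theta>)"
    unfolding rcis_def[abs_def] cis_conv_exp z_def
    by (auto intro!: derivative_eq_intros has_vector_derivative_real_field)
  ultimately have "(pseries c \<circ> rcis r has_vector_derivative (\<i> * z) * (\<Sum>m. diffs c m * z ^ m)) (at \<theta>)"
    unfolding z_def by (intro field_vector_diff_chain_at)
  moreover have "pseries (\<lambda>m. \<i> * of_nat m * c m) z = \<i> * z * (\<Sum>m. diffs c m * z ^ m)"
    unfolding pseries_def using eq[OF z] by (simp add: sums_iff)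
  ultimately show "((\<lambda>\<theta>. pseries c (rcis r \<theta>)) has_vector_derivative
      pseries (\<lambda>m. \<i> * of_nat m * c m) (rcis r \<theta>)) (at \<theta>)"
    unfolding z_def o_def by simp
qed

lemma D_theta_pseries:
  assumes sm: "disc_summable (\<lambda>m. cmod (a m))" and f: "\<And>z. cmod z < 1 \<Longrightarrow> f z = pseries a z"
  shows "disc_summable (\<lambda>m. cmod ((\<i> * of_nat m) ^ K * a m))"
    and "cmod z < 1 \<Longrightarrow> D_theta K f z = pseries (\<lambda>m. (\<i> * of_nat m) ^ K * a m) z"
proof -
  \<comment> \<open>The induction compares functions on a whole circle of radius r, because
    differentiating needs all angles; specialising to \<open>Arg z\<close> comes last.\<close>
  have *: "disc_summable (\<lambda>m. cmod ((\<i> * of_nat m) ^ K * a m)) \<and>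
    (\<forall>r. 0 \<le> r \<and> r < 1 \<longrightarrow> ((\<lambda>u \<theta>. vector_derivative u (at \<theta>)) ^^ K) (\<lambda>\<theta>. f (rcis r \<theta>)) =
      (\<lambda>\<theta>. pseries (\<lambda>m. (\<i> * of_nat m) ^ K * a m) (rcis r \<theta>)))" for K
  proof (induction K)
    case 0
    show ?case using sm f by auto
  next
    case (Suc K)
    note A = pseries_angular_derivative[OF Suc[THEN conjunct1]]
    have "disc_summable (\<lambda>m. cmod ((\<i> * of_nat m) ^ Suc K * a m))"
      using A(1) by (simp add: mult.assoc)
    moreover have "((\<lambda>u \<theta>. vector_derivative u (at \<theta>)) ^^ Suc K) (\<lambda>\<theta>. f (rcis r \<theta>)) =
      (\<lambda>\<theta>. pseries (\<lambda>m. (\<i> * of_nat m) ^ Suc K * a m) (rcis r \<theta>))" if r: "0 \<le> r" "r < 1" for r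
      using Suc r vector_derivative_at[OF A(2)[OF r]] by (simp add: mult.assoc)
    ultimately show ?case by blast
  qed
  show "disc_summable (\<lambda>m. cmod ((\<i> * of_nat m) ^ K * a m))" using * by blast
  show "D_theta K f z = pseries (\<lambda>m. (\<i> * of_nat m) ^ K * a m) z" if "cmod z < 1"
    using *[of K] that by (simp add: D_theta_def rcis_cmod_Arg)
qed

lemma holomorphic_pseries:
  assumes "f holomorphic_on ball 0 1"
  defines "a \<equiv> \<lambda>m. (deriv ^^ m) f 0 / fact m"
  shows "disc_summable (\<lambda>m. cmod (a m))" and "cmod z < 1 \<Longrightarrow> f z = pseries a z"
proof -
  have *: "(\<lambda>m. a m * z ^ m) sums f z" if "cmod z < 1" for z
    using holomorphic_power_series[OF assms(1), of z] that by (simp add: a_def)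
  show "disc_summable (\<lambda>m. cmod (a m))"
    by (rule disc_summable_norm) (use * sums_summable in blast)
  show "cmod z < 1 \<Longrightarrow> f z = pseries a z"
    using * by (simp add: pseries_def sums_iff)
qed

text \<open>The Zygmund condition speaks of \<open>bergman_norm\<close>, which is informative only
  once the second difference is known to have finite norm. The crude bound 4r from the triangle
  inequality supplies this.\<close>

lemma pnorm_le_second_difference:
  assumes p: "p > 1" and sm: "disc_summable (\<lambda>m. cmod (b m))"
    and g: "\<And>z. cmod z < 1 \<Longrightarrow> g z = pseries b z" and int: "integrable (area_measure \<alpha>) (\<lambda>z. cmod (g z) powr p)"
    and C: "zygmund_bound 1 p \<alpha> g C" and v: "v > 0"
  shows "pnorm_le p \<alpha> (\<lambda>m. b m * of_real (2 * cos (real m * v) - 2)) (C * v)"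
proof -
  define I where "I = (LINT z|area_measure \<alpha>. cmod (g z) powr p)"
  \<comment> \<open>The added 1 keeps the radius positive even if g vanishes.\<close>
  define r where "r = (I + 1) powr (1 / p)"
  have I0: "I \<ge> 0" by (simp add: I_def)
  have r: "r > 0" "r powr p = I + 1" using I0 p by (simp_all add: r_def powr_powr)
  have "(\<integral>\<^sup>+z. ennreal (cmod (pseries b z) powr p) \<partial>area_measure \<alpha>) =
      (\<integral>\<^sup>+z. ennreal (cmod (g z) powr p) \<partial>area_measure \<alpha>)"
    by (intro nn_integral_cong) (simp add: g)
  also have "\<dots> = ennreal I" unfolding I_def using int by (intro nn_integral_eq_integral) auto
  finally have b: "pnorm_le p \<alpha> b r"
    unfolding pnorm_le_def r(2) by (simp add: ennreal_leI)
  have sm': "disc_summable (\<lambda>m. cmod (b m * of_real (cos (real m * v))))"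
    by (rule disc_summable_le[OF sm]) (auto simp: norm_mult mult_left_le)
  have "pnorm_le p \<alpha> (\<lambda>m. of_real 2 * (b m * of_real (cos (real m * v))) + of_real (-2) * b m) (\<bar>2\<bar> * r + \<bar>-2\<bar> * r)"
    by (intro pnorm_le_lincomb p pnorm_le_cos_sin b r sm sm')
  also have "(\<lambda>m. of_real 2 * (b m * of_real (cos (real m * v))) + of_real (-2) * b m) =
      (\<lambda>m. b m * of_real (2 * cos (real m * v) - 2))"
    by (auto simp: fun_eq_iff algebra_simps)
  finally have fin: "pnorm_le p \<alpha> (\<lambda>m. b m * of_real (2 * cos (real m * v) - 2)) (\<bar>2\<bar> * r + \<bar>-2\<bar> * r)" .
  show ?thesis
  proof (rule pnorm_le_bergman_norm[OF p fin])
    show "bergman_norm p \<alpha> (\<lambda>z. g (cis v * z) + g (cis (- v) * z) - 2 * g z) \<le> C * v"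
      using C v by (auto simp: zygmund_bound_def dest: spec[of _ v])
    fix z :: complex assume z: "cmod z < 1"
    have s: "summable (\<lambda>m. b m * w ^ m)" if "cmod w < 1" for w
      by (rule pseries_summable[OF sm order_refl that])
    have zv: "cmod (cis v * z) < 1" "cmod (cis (-v) * z) < 1" using z by (simp_all add: norm_mult)
    have "b m * (cis v * z) ^ m + b m * (cis (- v) * z) ^ m - 2 * (b m * z ^ m) =
        b m * of_real (2 * cos (real m * v) - 2) * z ^ m" for m
    proof -
      have "cis v ^ m + cis (- v) ^ m = of_real (2 * cos (real m * v))"
        by (simp add: Complex.DeMoivre complex_eq_iff)
      then have "b m * (cis v ^ m + cis (- v) ^ m) * z ^ m = b m * of_real (2 * cos (real m * v)) * z ^ m"
        by simp
      then show ?thesis by (simp add: power_mult_distrib algebra_simps)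
    qed
    moreover have "(\<lambda>m. b m * (cis v * z) ^ m + b m * (cis (- v) * z) ^ m - 2 * (b m * z ^ m)) sums
        (pseries b (cis v * z) + pseries b (cis (- v) * z) - 2 * pseries b z)"
      unfolding pseries_def using s[OF z] s[OF zv(1)] s[OF zv(2)]
      by (intro sums_diff sums_add sums_mult summable_sums)
    ultimately show "g (cis v * z) + g (cis (- v) * z) - 2 * g z =
        pseries (\<lambda>m. b m * of_real (2 * cos (real m * v) - 2)) z"
      using g z zv by (simp add: pseries_def sums_iff)
  qed
qed

section \<open>The multiplier identity and the final estimate\<close>

text \<open>The unimodular \<open>e\<close> removes both the phase \<open>\<i> ^ K\<close> of the
  derivative and the sign of the transform. The second difference equals -(m\<delta>)^2 s, so
  dividing it by \<sigma>^(K+2) \<delta>^2 and multiplying by the transform of order K + 2 cancels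
  all powers of m.\<close>

lemma Jackson_multiplier_identity:
  fixes K m n :: nat and a :: complex
  assumes "n \<ge> 1"
  defines "\<sigma> \<equiv> real n / 2" and "\<delta> \<equiv> 4 * pi / real n"
  defines "x \<equiv> real m / \<sigma>" and "b \<equiv> (\<i> * of_nat m) ^ K * a"
  defines "\<phi> \<equiv> trapezoid x" and "s \<equiv> fejer (real m * \<delta>)"
  defines "e \<equiv> (if K = 0 then 1 else (-1) ^ ((K - 1) div 2) / \<i> ^ K :: complex)"
  shows "a * (1 - of_real (\<phi> * (if K = 0 then s else 1))) =
    e / of_real \<sigma> ^ K * (b * of_real (1 - s) * of_real (if K = 0 then 1 else 4 / pi * H_transform K x)) +
    (if K = 0 then -1 else e) / (of_real \<sigma> ^ (K + 2) * of_real \<delta> ^ 2) *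
      (b * of_real (2 * cos (real m * \<delta>) - 2) * of_real (4 / pi * H_transform (K + 2) x))"
\<comment> \<open>The transform formula needs x > 0. For the constant term both sides are 0, since
  \<phi> = s = 1.\<close>
proof (cases "m = 0")
  case True
  have "trapezoid 0 = 1" by (simp add: trapezoid_def)
  then show ?thesis
    using True by (cases "K = 0") (simp_all add: x_def \<phi>_def s_def b_def fejer_def)
next
  case False
  have \<sigma>: "\<sigma> > 0" and \<delta>: "\<delta> > 0" and x: "x > 0"
    using assms(1) False by (simp_all add: \<sigma>_def \<delta>_def x_def)
  have m: "real m = x * \<sigma>" using \<sigma> by (simp add: x_def)
  have cos: "2 * cos (real m * \<delta>) - 2 = - s * (x * \<sigma> * \<delta>)\<^sup>2"
  proof -
    have y: "real m * \<delta> \<noteq> 0" using False \<delta> by simp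
    then have "s * (real m * \<delta>)\<^sup>2 = 2 - 2 * cos (real m * \<delta>)"
      unfolding s_def fejer_def by simp
    then show ?thesis by (simp only: m)
  qed
  have b: "b = \<i> ^ K * of_real (x ^ K * \<sigma> ^ K) * a"
  proof -
    have "(of_nat m :: complex) = of_real (x * \<sigma>)" unfolding m[symmetric] by simp
    then have "b = (\<i> * of_real (x * \<sigma>)) ^ K * a" unfolding b_def by simp
    then show ?thesis by (simp add: power_mult_distrib)
  qed
  show ?thesis
  proof (cases "K = 0")
    case True
    have H2: "4 / pi * H_transform 2 x = (1 - \<phi>) / x\<^sup>2"
      using H_transform_eq[OF x, of 2] x by (simp add: \<phi>_def divide_simps mult_ac)
    have K2: "K + 2 = 2" using True by simp
    have H: "4 / pi * H_transform (K + 2) x = (1 - \<phi>) / x\<^sup>2" unfolding K2 by (rule H2)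
    have R: "- 1 / (\<sigma>\<^sup>2 * \<delta>\<^sup>2) * (- s * (x * \<sigma> * \<delta>)\<^sup>2 * ((1 - \<phi>) / x\<^sup>2)) = s * (1 - \<phi>)"
      using x \<sigma> \<delta> by (simp add: power_mult_distrib)
    have "(-1) / (of_real \<sigma> ^ (K + 2) * of_real \<delta> ^ 2) *
        (b * of_real (- s * (x * \<sigma> * \<delta>)\<^sup>2) * of_real ((1 - \<phi>) / x\<^sup>2)) =
        a * of_real (- 1 / (\<sigma>\<^sup>2 * \<delta>\<^sup>2) * (- s * (x * \<sigma> * \<delta>)\<^sup>2 * ((1 - \<phi>) / x\<^sup>2)))"
      unfolding b K2 using True by simp
    then show ?thesis
      unfolding cos H R if_P[OF True] using True b by (simp add: e_def algebra_simps)
  next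
    case False
    define \<epsilon> :: real where "\<epsilon> = (-1) ^ ((K - 1) div 2)"
    have \<epsilon>: "\<epsilon> * \<epsilon> = 1" unfolding \<epsilon>_def by (simp flip: power_mult_distrib)
    have e: "e = of_real \<epsilon> / \<i> ^ K" using False by (simp add: e_def \<epsilon>_def)
    have HK: "4 / pi * H_transform K x = \<epsilon> * (1 - \<phi>) / x ^ K"
      using H_transform_eq[OF x, of K] False by (simp add: \<phi>_def \<epsilon>_def)
    \<comment> \<open>Raising the order by 2 flips the sign of the transform, which cancels the
      minus sign of the second difference; so for K \<ge> 1 the same \<open>e\<close> fits both
      summands.\<close>
    have "(K + 2 - 1) div 2 = Suc ((K - 1) div 2)" using False by (cases K) auto
    then have HK2: "4 / pi * H_transform (K + 2) x = - \<epsilon> * (1 - \<phi>) / (x ^ K * x\<^sup>2)"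
      using H_transform_eq[OF x, of "K + 2"] by (simp add: \<phi>_def \<epsilon>_def power2_eq_square)
    have R: "\<epsilon> / \<sigma> ^ K * (x ^ K * \<sigma> ^ K) * ((1 - s) * (\<epsilon> * (1 - \<phi>) / x ^ K)) = \<epsilon> * \<epsilon> * (1 - s) * (1 - \<phi>)"
      "\<epsilon> / (\<sigma> ^ (K + 2) * \<delta>\<^sup>2) * (x ^ K * \<sigma> ^ K) *
        (- s * (x * \<sigma> * \<delta>)\<^sup>2 * (- \<epsilon> * (1 - \<phi>) / (x ^ K * x\<^sup>2))) = \<epsilon> * \<epsilon> * s * (1 - \<phi>)"
      using x \<sigma> \<delta> by (simp_all add: power2_eq_square)
    have U: "e / of_real \<sigma> ^ K * (b * of_real (1 - s) * of_real (\<epsilon> * (1 - \<phi>) / x ^ K)) =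
        a * of_real (\<epsilon> * \<epsilon> * (1 - s) * (1 - \<phi>))"
      unfolding R(1)[symmetric] e b by simp
    have V: "e / (of_real \<sigma> ^ (K + 2) * of_real \<delta> ^ 2) *
        (b * of_real (- s * (x * \<sigma> * \<delta>)\<^sup>2) * of_real (- \<epsilon> * (1 - \<phi>) / (x ^ K * x\<^sup>2))) =
        a * of_real (\<epsilon> * \<epsilon> * s * (1 - \<phi>))"
      unfolding R(2)[symmetric] e b by (simp add: mult_ac)
    show ?thesis
      using False unfolding cos HK HK2 if_not_P[OF False] U V \<epsilon> by (simp add: algebra_simps)
  qed
qed

text \<open>A multiplier that vanishes from n on cuts the Taylor series down to a polynomial, and
  this polynomial competes in the infimum. The dilated trapezoid qualifies because m \<ge> n means
  m/\<sigma> \<ge> 2.\<close>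

lemma best_approx_le:
  assumes p: "p > 1" and f: "\<And>z. cmod z < 1 \<Longrightarrow> f z = pseries a z"
    and a: "disc_summable (\<lambda>m. cmod (a m))" and q: "\<And>m. m \<ge> n \<Longrightarrow> q m = 0"
    and le: "pnorm_le p \<alpha> (\<lambda>m. a m * (1 - q m)) r" and r: "r \<ge> 0"
  shows "best_approx n p \<alpha> f \<le> r"
proof -
  define P where "P = (\<Sum>m<n. monom (a m * q m) m)"
  have P: "poly P z = (\<Sum>m<n. a m * q m * z ^ m)" for z
    by (simp add: P_def poly_sum poly_monom)
  have "degree P \<le> n"
    unfolding P_def by (rule degree_sum_le) (auto intro: order_trans[OF degree_monom_le])
  moreover have "bergman_norm p \<alpha> (\<lambda>z. f z - poly P z) \<le> r"
  proof (rule bergman_norm_le[OF p le r])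
    fix z :: complex assume z: "cmod z < 1"
    have "(\<lambda>m. a m * z ^ m) sums f z"
      using pseries_summable[OF a order_refl z] f[OF z] by (simp add: pseries_def sums_iff)
    moreover have "(\<lambda>m. a m * q m * z ^ m) sums poly P z"
      unfolding P by (rule sums_finite) (use q in auto)
    ultimately have "(\<lambda>m. a m * z ^ m - a m * q m * z ^ m) sums (f z - poly P z)"
      by (rule sums_diff)
    then show "f z - poly P z = pseries (\<lambda>m. a m * (1 - q m)) z"
      by (simp add: pseries_def sums_iff algebra_simps)
  qed
  moreover have "bdd_below {bergman_norm p \<alpha> (\<lambda>z. f z - poly P z) | P :: complex poly. degree P \<le> n}"
    by (rule bdd_belowI[of _ 0]) (auto simp: bergman_norm_def)
  ultimately show ?thesis
    unfolding best_approx_def by (intro cInf_lower2[of "bergman_norm p \<alpha> (\<lambda>z. f z - poly P z)"]) auto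
qed

lemma best_approx_le_zygmund:
  fixes n :: nat
  assumes p: "p > 1" and f: "\<And>z. cmod z < 1 \<Longrightarrow> f z = pseries a z"
    and a: "disc_summable (\<lambda>m. cmod (a m))"
    and b: "disc_summable (\<lambda>m. cmod ((\<i> * of_nat m) ^ K * a m))"
    and n: "n \<ge> 1" and M: "M > 0"
    and zyg: "\<And>v. v > 0 \<Longrightarrow>
      pnorm_le p \<alpha> (\<lambda>m. (\<i> * of_nat m) ^ K * a m * of_real (2 * cos (real m * v) - 2)) (M * v)"
  shows "best_approx n p \<alpha> f \<le> B_const K * M / (real n ^ K * real n)"
proof -
  define \<sigma> \<delta> where "\<sigma> = real n / 2" and "\<delta> = 4 * pi / real n"
  define \<b> where "\<b> = (\<lambda>m. (\<i> * of_nat m) ^ K * a m)"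
  define s where "s = (\<lambda>m. fejer (real m * \<delta>))"
  define q where "q = (\<lambda>m. trapezoid (real m / \<sigma>) * (if K = 0 then s m else 1))"
  define e :: complex where "e = (if K = 0 then 1 else (-1) ^ ((K - 1) div 2) / \<i> ^ K)"
  \<comment> \<open>For \<open>K = 0\<close> the part \<open>g - g\<^sub>\<delta>\<close> is left unapproximated, which is affordable as \<open>C\<^sub>0 \<ge> 1\<close>.\<close>
  define U where "U = (\<lambda>m. \<b> m * of_real (1 - s m) *
    of_real (if K = 0 then 1 else 4 / pi * H_transform K (real m / \<sigma>)))"
  define V where "V = (\<lambda>m. \<b> m * of_real (2 * cos (real m * \<delta>) - 2) *
    of_real (4 / pi * H_transform (K + 2) (real m / \<sigma>)))"
  define u v where "u = e / of_real \<sigma> ^ K"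
    and "v = (if K = 0 then -1 else e) / (of_real \<sigma> ^ (K + 2) * of_real \<delta> ^ 2)"
  have \<sigma>: "\<sigma> > 0" and \<delta>: "\<delta> > 0" using n by (simp_all add: \<sigma>_def \<delta>_def)
  have norm_e: "cmod e = 1" by (simp add: e_def norm_divide norm_power)
  have uv: "cmod u = 1 / \<sigma> ^ K" "cmod v = 1 / (\<sigma> ^ (K + 2) * \<delta>\<^sup>2)"
    using norm_e \<sigma> \<delta> by (simp_all add: u_def v_def norm_divide norm_mult norm_power)
  have sb: "disc_summable (\<lambda>m. cmod (\<b> m))" using b by (simp add: \<b>_def)
  have bdd: "disc_summable (\<lambda>m. cmod (\<b> m * of_real (w m)))" if "\<And>m. \<bar>w m\<bar> \<le> B" for w B
    by (rule disc_summable_le[OF disc_summable_cmult[OF sb, of B]])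
       (use that in \<open>auto simp: norm_mult mult.commute intro!: mult_right_mono\<close>)
  have cosb: "\<bar>2 * cos t - 2\<bar> \<le> 4" for t :: real
    using cos_le_one[of t] cos_ge_minus_one[of t] by linarith
  have fejb: "\<bar>1 - fejer t\<bar> \<le> 1" for t
  proof -
    have "2 - 2 * cos t \<le> t\<^sup>2"
      using cos_double_sin[of "t / 2"] abs_le_square_iff[THEN iffD1, OF abs_sin_x_le_abs_x[of "t / 2"]]
      by (simp add: power_divide)
    then show ?thesis
      using cos_le_one[of t] by (auto simp: fejer_def abs_le_iff divide_simps)
  qed
  have Hb: "\<bar>4 / pi * H_transform k t\<bar> \<le> C_const k" for k t
    using H_transform_le[of k t] by (simp add: abs_mult field_simps)
  have s1: "disc_summable (\<lambda>m. cmod (\<b> m * of_real (1 - s m)))"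
    unfolding s_def by (rule bdd) (rule fejb)
  have s2: "disc_summable (\<lambda>m. cmod (\<b> m * of_real (2 * cos (real m * \<delta>) - 2)))"
    by (rule bdd) (rule cosb)
  have G: "pnorm_le p \<alpha> (\<lambda>m. \<b> m * of_real (1 - s m)) (M * \<delta> / 6)"
    unfolding s_def by (rule pnorm_le_steklov[OF p M \<delta> sb]) (use zyg in \<open>simp add: \<b>_def\<close>)
  have U: "pnorm_le p \<alpha> U (C_const K * (M * \<delta> / 6))"
  proof (cases "K = 0")
    case True
    then have "U = (\<lambda>m. \<b> m * of_real (1 - s m))" by (simp add: U_def)
    then show ?thesis
      using pnorm_le_mono[OF G _ _ p, of "C_const K * (M * \<delta> / 6)"] M \<delta> True C_const_0_ge_1
        mult_right_mono[OF C_const_0_ge_1, of "M * \<delta> / 6"] by simp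
  next
    case False
    then have "U = (\<lambda>m. \<b> m * of_real (1 - s m) * of_real (4 / pi * H_transform K (real m / \<sigma>)))"
      by (simp add: U_def)
    then show ?thesis using pnorm_le_H_transform[OF p G _ s1, of K \<sigma>] M \<delta> by simp
  qed
  have V: "pnorm_le p \<alpha> V (C_const (K + 2) * (M * \<delta>))"
    unfolding V_def using M \<delta> zyg[OF \<delta>] by (intro pnorm_le_H_transform p s2) (simp_all add: \<b>_def)
  have mult_le: "disc_summable (\<lambda>m. cmod (c m * of_real (w m)))"
    if "disc_summable (\<lambda>m. cmod (c m))" "\<And>m. \<bar>w m\<bar> \<le> B" for c :: "nat \<Rightarrow> complex" and w B
    by (rule disc_summable_le[OF disc_summable_cmult[OF that(1), of B]])
       (use that(2) in \<open>auto simp: norm_mult mult.commute intro!: mult_right_mono\<close>)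
  have sU: "disc_summable (\<lambda>m. cmod (U m))"
    unfolding U_def by (rule mult_le[OF s1, where B = "max 1 (C_const K)"])
      (use Hb[of K] in \<open>auto simp: le_max_iff_disj\<close>)
  have sV: "disc_summable (\<lambda>m. cmod (V m))"
    unfolding V_def by (rule mult_le[OF s2 Hb])
  have scale: "disc_summable (\<lambda>m. cmod (w * c m))" if "disc_summable (\<lambda>m. cmod (c m))" for w :: complex and c
    using disc_summable_cmult[OF that, of "cmod w"] by (simp add: norm_mult)
  have R1: "C_const K * (M * \<delta> / 6) > 0" and R2: "C_const (K + 2) * (M * \<delta>) > 0"
    using C_const_pos M \<delta> by simp_all
  have "pnorm_le p \<alpha> (\<lambda>m. u * U m + v * V m)
      (cmod u * (C_const K * (M * \<delta> / 6)) + cmod v * (C_const (K + 2) * (M * \<delta>)))"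
  proof (rule pnorm_le_add[OF p pnorm_le_cmult[OF U sU] pnorm_le_cmult[OF V sV]])
    have "cmod u > 0" "cmod v > 0" unfolding uv using \<sigma> \<delta> by simp_all
    then show "0 < cmod u * (C_const K * (M * \<delta> / 6))" "0 < cmod v * (C_const (K + 2) * (M * \<delta>))"
      using R1 R2 by (blast intro: mult_pos_pos)+
  qed (use R1 R2 scale sU sV in auto)
  also have "(\<lambda>m. u * U m + v * V m) = (\<lambda>m. a m * (1 - of_real (q m)))"
    unfolding u_def v_def U_def V_def q_def s_def e_def \<b>_def \<sigma>_def \<delta>_def
    by (rule ext, rule Jackson_multiplier_identity[OF n, symmetric])
  finally have "best_approx n p \<alpha> f \<le>
      cmod u * (C_const K * (M * \<delta> / 6)) + cmod v * (C_const (K + 2) * (M * \<delta>))"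
  proof (intro best_approx_le[OF p f a])
    show "of_real (q m) = (0 :: complex)" if "m \<ge> n" for m
    proof -
      have "real m / \<sigma> \<ge> 2" using that n by (simp add: \<sigma>_def divide_simps)
      then show ?thesis by (simp add: q_def trapezoid_eq_0)
    qed
  qed (use R1 R2 in auto)
  \<comment> \<open>Here \<sigma>^(-K) \<delta>/6 = 2^K n^(-K-1) 2 pi/3 and \<sigma>^(-K-2)/\<delta>
    = 2^K n^(-K-1)/pi; the choice of \<delta> makes the second coefficient exactly 1/pi.\<close>
  also have "\<dots> = 2 ^ K * M * (2 / 3 * pi * C_const K + C_const (K + 2) / pi) / (real n ^ K * real n)"
    unfolding uv \<sigma>_def \<delta>_def using n by (simp add: power_divide field_simps power2_eq_square)
  also have "\<dots> \<le> 2 ^ K * M * (pi * C_const K + C_const (K + 2) / pi) / (real n ^ K * real n)"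
    using C_const_pos[of K] M by (intro divide_right_mono mult_left_mono) auto
  also have "\<dots> = B_const K * M / (real n ^ K * real n)"
    by (simp add: B_const_def algebra_simps)
  finally show ?thesis .
qed

theorem theorem2p4:
  fixes p \<alpha> M :: real and K n :: nat and f :: "complex \<Rightarrow> complex"
  assumes "1 < p" and "-1 < \<alpha>"
    and "f \<in> bergman_space p \<alpha>"
    and "D_theta K f \<in> zygmund_space 1 p \<alpha>"
    and "zygmund_seminorm 1 p \<alpha> (D_theta K f) = M"
    and "n \<ge> 1"
  shows "best_approx n p \<alpha> f \<le> B_const K * M * real n powi (- int K - 1)"
proof -
  define a where "a = (\<lambda>m. (deriv ^^ m) f 0 / fact m)"
  have hol: "f holomorphic_on ball 0 1" using assms(3) by (simp add: bergman_space_def)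
  have a: "disc_summable (\<lambda>m. cmod (a m))" "\<And>z. cmod z < 1 \<Longrightarrow> f z = pseries a z"
    unfolding a_def using holomorphic_pseries[OF hol] by auto
  have b: "disc_summable (\<lambda>m. cmod ((\<i> * of_nat m) ^ K * a m))"
    "\<And>z. cmod z < 1 \<Longrightarrow> D_theta K f z = pseries (\<lambda>m. (\<i> * of_nat m) ^ K * a m) z"
    by (rule D_theta_pseries; use a in blast)+
  have int: "integrable (area_measure \<alpha>) (\<lambda>z. cmod (D_theta K f z) powr p)"
    and "\<exists>C. zygmund_bound 1 p \<alpha> (D_theta K f) C"
    using assms(4) by (auto simp: zygmund_space_def bergman_space_def)
  then have ne: "{C. zygmund_bound 1 p \<alpha> (D_theta K f) C} \<noteq> {}" by simp
  \<comment> \<open>Testing the bound at t = 1 suffices, as norms are nonnegative. This gives M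
    \<ge> 0.\<close>
  have C0: "C \<ge> 0" if "zygmund_bound 1 p \<alpha> (D_theta K f) C" for C
  proof -
    have "0 \<le> bergman_norm p \<alpha> g" for g by (simp add: bergman_norm_def)
    also have "bergman_norm p \<alpha> (\<lambda>z. D_theta K f (cis 1 * z) + D_theta K f (cis (- 1) * z) - 2 * D_theta K f z)
        \<le> C * \<bar>1\<bar> powr 1"
      using that unfolding zygmund_bound_def by blast
    finally show ?thesis by simp
  qed
  have M0: "M \<ge> 0"
    unfolding assms(5)[symmetric] zygmund_seminorm_def using ne C0 by (intro cInf_greatest) auto
  \<comment> \<open>Every M' > M exceeds some admissible constant, so attainment of the infimum is
    not at issue, and M' is positive even when M = 0. Letting M' decrease to M finishes the
    proof.\<close>
  have le: "best_approx n p \<alpha> f \<le> B_const K * M' / (real n ^ K * real n)" if M': "M' > M" for M'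
  proof -
    obtain C where C: "zygmund_bound 1 p \<alpha> (D_theta K f) C" "C < M'"
      using cInf_lessD[OF ne, of M'] M' assms(5) by (auto simp: zygmund_seminorm_def)
    show ?thesis
    proof (rule best_approx_le_zygmund[OF assms(1) a(2) a(1) b(1) assms(6)])
      fix v :: real assume v: "v > 0"
      have "pnorm_le p \<alpha> (\<lambda>m. (\<i> * of_nat m) ^ K * a m * of_real (2 * cos (real m * v) - 2)) (C * v)"
        by (rule pnorm_le_second_difference[OF assms(1) b(1) b(2) int C(1) v])
      then show "pnorm_le p \<alpha> (\<lambda>m. (\<i> * of_nat m) ^ K * a m * of_real (2 * cos (real m * v) - 2)) (M' * v)"
        by (rule pnorm_le_mono) (use C C0[OF C(1)] v assms(1) in auto)
    qed (use M' M0 in auto)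
  qed
  have "((\<lambda>M'. B_const K * M' / (real n ^ K * real n)) \<longlongrightarrow> B_const K * M / (real n ^ K * real n)) (at_right M)"
    using assms(6) by (intro tendsto_intros) auto
  moreover have "eventually (\<lambda>M'. best_approx n p \<alpha> f \<le> B_const K * M' / (real n ^ K * real n)) (at_right M)"
    using eventually_at_right_less[of M] by eventually_elim (rule le)
  ultimately have "best_approx n p \<alpha> f \<le> B_const K * M / (real n ^ K * real n)"
    by (intro tendsto_lowerbound) auto
  also have "\<dots> = B_const K * M * real n powi (- int K - 1)"
  proof -
    have "- int K - 1 = - int (K + 1)" by simp
    then show ?thesis
      by (simp only: power_int_minus power_int_of_nat) (simp add: divide_inverse mult.commute)
  qed
  finally show ?thesis .
qed

end
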